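(* Let $\mathbf{C}$ be a subcategory of $\mathbf{B}$ that is directed, has amalgamation, and in which the edge-witnessing morphisms are wide and the star-refining morphisms are wide. Then: (1) There is a Fraïssé sequence in $\mathbf{C}$. (2) Every morphism of $\mathbf{C}$ is edge-surjective, and both the edge-witnessing morphisms of $\mathbf{C}$ and the star-refining morphisms of $\mathbf{C}$ form wide ideals of $\mathbf{C}$. (3) Every lax-Fraïssé sequence in $\mathbf{C}$ is edge-faithful, has an edge-witnessing subsequence and has a star-refining subsequence. (4) All lax-Fraïssé sequences in $\mathbf{C}$ have homeomorphic spectra. (5) The spectrum of any lax-Fraïssé sequence in $\mathbf{C}$ is metrizable.
   Context: Graphs and relations. A graph is a finite non-empty set $G$ with a reflexive symmetric relation $\sqcap$ (the edge relation). A relation $R\subseteq H\times G$ between graphs is viewed as a relation from $G$ to $H$; write $R(g)=\{h:(h,g)\in R\}$ and $R^{-1}(h)=\{g:(h,g)\in R\}$; $(c,a)\in Q\circ R$ iff $(c,b)\in Q$ and $(b,a)\in R$ for some $b$. $R$ is: edge-preserving if $(h,g),(h',g')\in R$ and $g\sqcap g'$ imply $h\sqcap h'$; co-surjective if $R(g)\neq\emptyset$ for all $g\in G$; co-injective if for all $h\in H$ there is $g\in G$ with $R(g)=\{h\}$; co-bijective if co-injective and co-surjective; edge-surjective if $h\sqcap h'$ implies there are $g\sqcap g'$ with $(h,g),(h',g')\in R$; edge-witnessing if $h\sqcap h'$ implies there is $g$ with $(h,g),(h',g)\in R$; star-refining if for all $g\in G$ there is $h\in H$ with $\{g':g'\sqcap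 g\}\subseteq R^{-1}(h)$. $\mathbf{B}$ is the category of graphs with co-bijective edge-preserving relations as morphisms. Categories. $\mathbf{C}^H_G$ denotes the set of morphisms of $\mathbf C$ from $G$ to $H$. A class $M$ of morphisms of $\mathbf{C}$ is wide if every object $H$ of $\mathbf C$ is the codomain of some member of $M$, and an ideal if it is closed under composition on both sides with arbitrary morphisms of $\mathbf{C}$. $\mathbf{C}$ is directed if it is non-empty and any two objects are codomains of morphisms with a common domain. $\mathbf{C}$ has amalgamation if for all $R\in\mathbf{C}^G_H$, $Q\in\mathbf{C}^G_I$ there are $J$, $R'\in\mathbf{C}^H_J$, $Q'\in\mathbf{C}^I_J$ with $R\circ R'=Q\circ Q'$. Sequences. A sequence in $\mathbf{C}$ is a family $(G_n,R^m_n)_{m\le n\in\omega}$ with $R^m_n\in\mathbf{C}^{G_m}_{G_n}$, $R^n_n$ the identity and $R^l_m\circ R^m_n=R^l_n$ for $l\le m\le n$. It has a property of morphisms (e.g. edge-witnessing) if $R^m_n$ has it for all $m<n$. A subsequence is $(G_{\phi(n)},R^{\phi(m)}_{\phi(n)})$ for a strictly increasing $\phi:\omega\to\omega$. A sequence in $\mathbf{C}$ is Fraïssé (resp. lax-Fraïssé) if it is cofinal, i.e. for every object $G$ of $\mathbf{C}$ some $\mathbf{C}^G_{G_n}$ is non-empty, and for every $m$ and $Q\in\mathbf{C}^{G_m}_G$ there are $n\ge m$ and $P\in\mathbf{C}^G_{G_n}$ with $Q\circ P=R^m_n$ (resp. $Q\circ P\subseteq R^m_n$). Induced poset and spectrum.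 The induced poset of a sequence is the disjoint union $\mathbb{P}=\bigsqcup_nG_n$, where for $p\in G_n$, $q\in G_m$, $p\le q$ iff $m\le n$ and $(q,p)\in R^m_n$. The sequence is edge-faithful if for all $n$ and $g,h\in G_n$: $g\sqcap h$ iff $g,h$ have a common lower bound in $\mathbb{P}$. In a poset $\mathbb{P}$, a band is a finite $B\subseteq\mathbb{P}$ such that every element of $\mathbb{P}$ is comparable to an element of $B$; a cap is a set $C\subseteq\mathbb P$ for which there is a band $B$ such that each $b\in B$ is $\le$ some $c\in C$; a selector is a subset of $\mathbb{P}$ meeting every cap. The spectrum $\mathsf{S}\mathbb{P}$ is the set of minimal selectors (with respect to inclusion) with the topology generated by the sets $p^\in=\{S\in\mathsf{S}\mathbb{P}:p\in S\}$, $p\in\mathbb{P}$. The spectrum of a sequence is the spectrum of its induced poset.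
   Formalization: Part (1) additionally assumes that C has countably many objects up to isomorphism in C; without this it fails, e.g. for one-vertex graphs {p}, p in ω₁, with one morphism {q}→{p} whenever p ≤ q, which admits no cofinal sequence. *)

theory Defs
  imports "HOL-Analysis.Analysis"
begin

section \<open>Graphs and relations between them\<close>

record 'a graph =
  verts :: "'a set"
  edges :: "('a \<times> 'a) set"

definition is_graph :: "'a graph \<Rightarrow> bool" where
  "is_graph G \<longleftrightarrow> finite (verts G) \<and> verts G \<noteq> {} \<and> edges G \<subseteq> verts G \<times> verts G
     \<and> refl_on (verts G) (edges G) \<and> sym (edges G)"

text \<open>
  A relation \<open>R \<subseteq> H \<times> G\<close> is viewed as a relation from \<open>G\<close> to \<open>H\<close>. Predicates on relations
  take the domain \<open>G\<close> first, then the codomain \<open>H\<close>, and pairs in \<open>R\<close> are of the form \<open>(h, g)\<close>.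
  Hence \<open>R(g)\<close> is \<open>R\<inverse> `` {g}\<close>, \<open>R\<^sup>-\<^sup>1(h)\<close> is \<open>R `` {h}\<close>, and the composite \<open>Q \<circ> R\<close> is \<open>Q O R\<close>.
\<close>

definition edge_preserving :: "'a graph \<Rightarrow> 'a graph \<Rightarrow> ('a \<times> 'a) set \<Rightarrow> bool" where
  "edge_preserving G H R \<longleftrightarrow>
     (\<forall>h g h' g'. (h, g) \<in> R \<and> (h', g') \<in> R \<and> (g, g') \<in> edges G \<longrightarrow> (h, h') \<in> edges H)"

definition co_surjective :: "'a graph \<Rightarrow> 'a graph \<Rightarrow> ('a \<times> 'a) set \<Rightarrow> bool" where
  "co_surjective G H R \<longleftrightarrow> (\<forall>g\<in>verts G. R\<inverse> `` {g} \<noteq> {})"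

definition co_injective :: "'a graph \<Rightarrow> 'a graph \<Rightarrow> ('a \<times> 'a) set \<Rightarrow> bool" where
  "co_injective G H R \<longleftrightarrow> (\<forall>h\<in>verts H. \<exists>g\<in>verts G. R\<inverse> `` {g} = {h})"

definition co_bijective :: "'a graph \<Rightarrow> 'a graph \<Rightarrow> ('a \<times> 'a) set \<Rightarrow> bool" where
  "co_bijective G H R \<longleftrightarrow> co_injective G H R \<and> co_surjective G H R"

definition edge_surjective :: "'a graph \<Rightarrow> 'a graph \<Rightarrow> ('a \<times> 'a) set \<Rightarrow> bool" where
  "edge_surjective G H R \<longleftrightarrow>
     (\<forall>h h'. (h, h') \<in> edges H \<longrightarrow> (\<exists>g g'. (g, g') \<in> edges G \<and> (h, g) \<in> R \<and> (h', g') \<in> R))"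

definition edge_witnessing :: "'a graph \<Rightarrow> 'a graph \<Rightarrow> ('a \<times> 'a) set \<Rightarrow> bool" where
  "edge_witnessing G H R \<longleftrightarrow>
     (\<forall>h h'. (h, h') \<in> edges H \<longrightarrow> (\<exists>g\<in>verts G. (h, g) \<in> R \<and> (h', g) \<in> R))"

definition star_refining :: "'a graph \<Rightarrow> 'a graph \<Rightarrow> ('a \<times> 'a) set \<Rightarrow> bool" where
  "star_refining G H R \<longleftrightarrow>
     (\<forall>g\<in>verts G. \<exists>h\<in>verts H. {g'. (g', g) \<in> edges G} \<subseteq> R `` {h})"


section \<open>Categories of graphs\<close>

text \<open>\<open>hom C G H\<close> is the set of morphisms from \<open>G\<close> to \<open>H\<close>, i.e. \<open>\<^bold>C\<^sup>H\<^sub>G\<close>.\<close>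

record 'a graph_cat =
  objs :: "'a graph set"
  hom :: "'a graph \<Rightarrow> 'a graph \<Rightarrow> ('a \<times> 'a) set set"

definition cat_B :: "'a graph_cat" where
  "cat_B = \<lparr> objs = {G. is_graph G},
             hom = (\<lambda>G H. {R. is_graph G \<and> is_graph H \<and> R \<subseteq> verts H \<times> verts G
                              \<and> co_bijective G H R \<and> edge_preserving G H R}) \<rparr>"

definition subcategory_of_B :: "'a graph_cat \<Rightarrow> bool" where
  "subcategory_of_B C \<longleftrightarrow>
     objs C \<subseteq> objs cat_B \<and>
     (\<forall>G H R. R \<in> hom C G H \<longrightarrow> G \<in> objs C \<and> H \<in> objs C \<and> R \<in> hom cat_B G H) \<and>
     (\<forall>G\<in>objs C. Id_on (verts G) \<in> hom C G G) \<and>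
     (\<forall>G H I R Q. R \<in> hom C G H \<and> Q \<in> hom C H I \<longrightarrow> Q O R \<in> hom C G I)"

text \<open>
  A class of morphisms of \<open>C\<close> is given by a property \<open>M\<close> of morphisms: it consists of those
  \<open>R \<in> hom C G H\<close> for which \<open>M G H R\<close> holds.
\<close>

definition wide :: "'a graph_cat \<Rightarrow> ('a graph \<Rightarrow> 'a graph \<Rightarrow> ('a \<times> 'a) set \<Rightarrow> bool) \<Rightarrow> bool" where
  "wide C M \<longleftrightarrow> (\<forall>H\<in>objs C. \<exists>G\<in>objs C. \<exists>R\<in>hom C G H. M G H R)"

definition ideal :: "'a graph_cat \<Rightarrow> ('a graph \<Rightarrow> 'a graph \<Rightarrow> ('a \<times> 'a) set \<Rightarrow> bool) \<Rightarrow> bool" where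
  "ideal C M \<longleftrightarrow>
     (\<forall>G H I R Q. R \<in> hom C G H \<and> Q \<in> hom C H I \<and> (M G H R \<or> M H I Q) \<longrightarrow> M G I (Q O R))"

definition directed :: "'a graph_cat \<Rightarrow> bool" where
  "directed C \<longleftrightarrow> objs C \<noteq> {} \<and>
     (\<forall>G\<in>objs C. \<forall>H\<in>objs C. \<exists>I\<in>objs C. hom C I G \<noteq> {} \<and> hom C I H \<noteq> {})"

definition has_amalgamation :: "'a graph_cat \<Rightarrow> bool" where
  "has_amalgamation C \<longleftrightarrow>
     (\<forall>G H I R Q. R \<in> hom C H G \<and> Q \<in> hom C I G \<longrightarrow>
        (\<exists>J\<in>objs C. \<exists>R'\<in>hom C J H. \<exists>Q'\<in>hom C J I. R O R' = Q O Q'))"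

text \<open>
  Up to isomorphism there are only countably many finite graphs, but a subcategory of \<open>\<^bold>B\<close> need
  not contain the isomorphisms of \<open>\<^bold>B\<close> between its objects. Some countability is needed for
  Fraisse sequences to exist: if vertices are taken from an uncountable well-order all of whose
  countable subsets are bounded, the one-vertex graphs with a single morphism from \<open>{q}\<close> to \<open>{p}\<close>
  whenever \<open>p \<le> q\<close> form a directed subcategory with amalgamation, all of whose morphisms are
  edge-witnessing and star-refining, but which has no cofinal sequence. The condition below is
  automatic when vertices are taken from a countable set, see \<open>essentially_countable_if_countable\<close>.
  Morphism sets of \<open>\<^bold>B\<close> are finite, so only objects have to be counted.
\<close>

definition isomorphic_in :: "'a graph_cat \<Rightarrow> 'a graph \<Rightarrow> 'a graph \<Rightarrow> bool" where
  "isomorphic_in C G H \<longleftrightarrow>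
     (\<exists>R\<in>hom C G H. \<exists>Q\<in>hom C H G. Q O R = Id_on (verts G) \<and> R O Q = Id_on (verts H))"

definition essentially_countable :: "'a graph_cat \<Rightarrow> bool" where
  "essentially_countable C \<longleftrightarrow>
     (\<exists>D. countable D \<and> D \<subseteq> objs C \<and> (\<forall>G\<in>objs C. \<exists>H\<in>D. isomorphic_in C G H))"

lemma essentially_countable_if_countable:
  fixes C :: "'a::countable graph_cat"
  assumes "subcategory_of_B C"
  shows "essentially_countable C"
proof -
  let ?code = "\<lambda>G :: 'a graph. (verts G, edges G)"
  have fin: "finite (verts G) \<and> finite (edges G)" if "G \<in> objs C" for G
  proof -
    have "finite (verts G)" and "edges G \<subseteq> verts G \<times> verts G"
      using that assms by (auto simp: subcategory_of_B_def cat_B_def is_graph_def)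
    then show ?thesis
      by (meson finite_SigmaI finite_subset)
  qed
  have "?code ` objs C \<subseteq> {A. finite A} \<times> {A. finite A}"
    using fin by auto
  moreover have "countable ({A :: 'a set. finite A} \<times> {A :: ('a \<times> 'a) set. finite A})"
    by (rule countable_SIGMA[OF countable_Collect_finite countable_Collect_finite])
  ultimately have "countable (?code ` objs C)"
    by (rule countable_subset)
  moreover have "inj_on ?code (objs C)"
    by (auto intro: inj_onI)
  ultimately have "countable (objs C)"
    by (simp add: countable_image_inj_eq)
  moreover have "isomorphic_in C G G" if "G \<in> objs C" for G
  proof -
    have "Id_on (verts G) \<in> hom C G G"
      using assms that by (auto simp: subcategory_of_B_def)
    moreover have "Id_on (verts G) O Id_on (verts G) = Id_on (verts G)"
      by auto
    ultimately show ?thesis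
      unfolding isomorphic_in_def by blast
  qed
  ultimately show ?thesis
    unfolding essentially_countable_def by blast
qed


section \<open>Sequences\<close>

text \<open>\<open>R m n\<close> is the relation \<open>R\<^sup>m\<^sub>n\<close> from \<open>G n\<close> to \<open>G m\<close>; it is only meaningful for \<open>m \<le> n\<close>.\<close>

definition sequence_in ::
    "'a graph_cat \<Rightarrow> (nat \<Rightarrow> 'a graph) \<Rightarrow> (nat \<Rightarrow> nat \<Rightarrow> ('a \<times> 'a) set) \<Rightarrow> bool" where
  "sequence_in C G R \<longleftrightarrow>
     (\<forall>n. G n \<in> objs C) \<and>
     (\<forall>m n. m \<le> n \<longrightarrow> R m n \<in> hom C (G n) (G m)) \<and>
     (\<forall>n. R n n = Id_on (verts (G n))) \<and>
     (\<forall>l m n. l \<le> m \<and> m \<le> n \<longrightarrow> R l m O R m n = R l n)"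

definition seq_has ::
    "('a graph \<Rightarrow> 'a graph \<Rightarrow> ('a \<times> 'a) set \<Rightarrow> bool)
      \<Rightarrow> (nat \<Rightarrow> 'a graph) \<Rightarrow> (nat \<Rightarrow> nat \<Rightarrow> ('a \<times> 'a) set) \<Rightarrow> bool" where
  "seq_has M G R \<longleftrightarrow> (\<forall>m n. m < n \<longrightarrow> M (G n) (G m) (R m n))"

definition has_subseq_with ::
    "('a graph \<Rightarrow> 'a graph \<Rightarrow> ('a \<times> 'a) set \<Rightarrow> bool)
      \<Rightarrow> (nat \<Rightarrow> 'a graph) \<Rightarrow> (nat \<Rightarrow> nat \<Rightarrow> ('a \<times> 'a) set) \<Rightarrow> bool" where
  "has_subseq_with M G R \<longleftrightarrow>
     (\<exists>\<phi> :: nat \<Rightarrow> nat. strict_mono \<phi> \<and> seq_has M (\<lambda>n. G (\<phi> n)) (\<lambda>m n. R (\<phi> m) (\<phi> n)))"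

definition cofinal_seq :: "'a graph_cat \<Rightarrow> (nat \<Rightarrow> 'a graph) \<Rightarrow> bool" where
  "cofinal_seq C G \<longleftrightarrow> (\<forall>H\<in>objs C. \<exists>n. hom C (G n) H \<noteq> {})"

definition fraisse_sequence ::
    "'a graph_cat \<Rightarrow> (nat \<Rightarrow> 'a graph) \<Rightarrow> (nat \<Rightarrow> nat \<Rightarrow> ('a \<times> 'a) set) \<Rightarrow> bool" where
  "fraisse_sequence C G R \<longleftrightarrow> sequence_in C G R \<and> cofinal_seq C G \<and>
     (\<forall>m. \<forall>H\<in>objs C. \<forall>Q\<in>hom C H (G m). \<exists>n\<ge>m. \<exists>P\<in>hom C (G n) H. Q O P = R m n)"

definition lax_fraisse_sequence ::
    "'a graph_cat \<Rightarrow> (nat \<Rightarrow> 'a graph) \<Rightarrow> (nat \<Rightarrow> nat \<Rightarrow> ('a \<times> 'a) set) \<Rightarrow> bool" where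
  "lax_fraisse_sequence C G R \<longleftrightarrow> sequence_in C G R \<and> cofinal_seq C G \<and>
     (\<forall>m. \<forall>H\<in>objs C. \<forall>Q\<in>hom C H (G m). \<exists>n\<ge>m. \<exists>P\<in>hom C (G n) H. Q O P \<subseteq> R m n)"


section \<open>Spectra of posets\<close>

text \<open>A poset is given by a carrier \<open>A\<close> and a relation \<open>r\<close>, where \<open>(p, q) \<in> r\<close> means \<open>p \<le> q\<close>.\<close>

definition is_band :: "'p set \<Rightarrow> ('p \<times> 'p) set \<Rightarrow> 'p set \<Rightarrow> bool" where
  "is_band A r B \<longleftrightarrow> finite B \<and> B \<subseteq> A \<and> (\<forall>p\<in>A. \<exists>b\<in>B. (p, b) \<in> r \<or> (b, p) \<in> r)"

definition is_cap :: "'p set \<Rightarrow> ('p \<times> 'p) set \<Rightarrow> 'p set \<Rightarrow> bool" where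
  "is_cap A r K \<longleftrightarrow> K \<subseteq> A \<and> (\<exists>B. is_band A r B \<and> (\<forall>b\<in>B. \<exists>c\<in>K. (b, c) \<in> r))"

definition is_selector :: "'p set \<Rightarrow> ('p \<times> 'p) set \<Rightarrow> 'p set \<Rightarrow> bool" where
  "is_selector A r S \<longleftrightarrow> S \<subseteq> A \<and> (\<forall>K. is_cap A r K \<longrightarrow> S \<inter> K \<noteq> {})"

definition spectrum :: "'p set \<Rightarrow> ('p \<times> 'p) set \<Rightarrow> 'p set set" where
  "spectrum A r = {S. is_selector A r S \<and> (\<forall>T. is_selector A r T \<and> T \<subseteq> S \<longrightarrow> T = S)}"

text \<open>
  The whole spectrum is added to the subbasis because the carrier of
  \<open>topology_generated_by\<close> is the union of the given sets.
\<close>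

definition spectrum_top :: "'p set \<Rightarrow> ('p \<times> 'p) set \<Rightarrow> 'p set topology" where
  "spectrum_top A r =
     topology_generated_by (insert (spectrum A r) ((\<lambda>p. {S \<in> spectrum A r. p \<in> S}) ` A))"


section \<open>The poset induced by a sequence\<close>

definition ind_poset :: "(nat \<Rightarrow> 'a graph) \<Rightarrow> (nat \<times> 'a) set" where
  "ind_poset G = (SIGMA n:UNIV. verts (G n))"

definition ind_order ::
    "(nat \<Rightarrow> 'a graph) \<Rightarrow> (nat \<Rightarrow> nat \<Rightarrow> ('a \<times> 'a) set) \<Rightarrow> ((nat \<times> 'a) \<times> (nat \<times> 'a)) set" where
  "ind_order G R = {((n, p), (m, q)) | n p m q.
     p \<in> verts (G n) \<and> q \<in> verts (G m) \<and> m \<le> n \<and> (q, p) \<in> R m n}"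

definition edge_faithful ::
    "(nat \<Rightarrow> 'a graph) \<Rightarrow> (nat \<Rightarrow> nat \<Rightarrow> ('a \<times> 'a) set) \<Rightarrow> bool" where
  "edge_faithful G R \<longleftrightarrow>
     (\<forall>n. \<forall>g\<in>verts (G n). \<forall>h\<in>verts (G n).
        (g, h) \<in> edges (G n) \<longleftrightarrow>
        (\<exists>x\<in>ind_poset G. (x, (n, g)) \<in> ind_order G R \<and> (x, (n, h)) \<in> ind_order G R))"

definition seq_spectrum ::
    "(nat \<Rightarrow> 'a graph) \<Rightarrow> (nat \<Rightarrow> nat \<Rightarrow> ('a \<times> 'a) set) \<Rightarrow> (nat \<times> 'a) set topology" where
  "seq_spectrum G R = spectrum_top (ind_poset G) (ind_order G R)"

end

theory Submission
  imports Defs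
begin

text \<open>
  The minimal selectors of the poset induced by a sequence are the minimal up-closed sets meeting
  every level, and an up-closed set \<open>S\<close> meeting every level is minimal iff each \<open>s \<in> S\<close> lies
  above an entire level of \<open>S\<close>. Hence the levels of a minimal selector are cliques, the sets
  \<open>p\<^sup>\<in>\<close> form a base, and the spectrum is compact. If every level is star-refined by a later one,
  then distinct minimal selectors have a level at which none of their elements are adjacent, so the
  spectrum is Hausdorff, and being second countable it is metrizable.

  The same separation argument shows that the spectrum does not change when one passes to a
  subsequence and shrinks its relations, as long as the result is still star-refining.
  For two lax-Fraisse sequences a back-and-forth construction gives a sequence in \<open>C\<close>
  whose even and odd terms form subsequences of the two sequences, with smaller relations,
  so all three spectra are homeomorphic.

  Fraisse sequences are built by amalgamation. Edge-surjectivity of \<open>R\<close> comes from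
  amalgamating \<open>R\<close> with an edge-witnessing morphism, and is what makes the edge-witnessing
  morphisms an ideal.
\<close>

section \<open>Metrization of compact spaces\<close>

text \<open>Urysohn functions for the pairs of base sets with disjoint closures are countably many
  and separate points, so together they map \<open>X\<close> continuously and injectively into a
  countable product of lines. Compactness turns this map into an embedding.\<close>

lemma metrizable_space_compact_Hausdorff_second_countable:
  assumes "compact_space X" and "Hausdorff_space X" and "second_countable X"
  shows "metrizable_space X"
proof -
  have reg: "regular_space X" and normal: "normal_space X"
    using assms(1,2) by (auto simp: compact_Hausdorff_imp_regular_space compact_Hausdorff_or_regular_imp_normal_space)
  obtain \<B> where "countable \<B>" and open_\<B>: "\<And>V. V \<in> \<B> \<Longrightarrow> openin X V"
    and base: "\<And>U x. openin X U \<Longrightarrow> x \<in> U \<Longrightarrow> \<exists>V\<in>\<B>. x \<in> V \<and> V \<subseteq> U"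
    using assms(3) unfolding second_countable_def by metis
  \<comment> \<open>Adding the empty set makes the base non-empty, so that it can be enumerated by
    \<open>nat\<close>.\<close>
  then obtain b :: "nat \<Rightarrow> 'a set" where b: "insert {} \<B> = range b"
    by (metis countable_insert insert_not_empty uncountable_def)
  \<comment> \<open>The implication lets \<open>f\<close> be chosen for all index pairs; where the
    closures meet, the constant 0 serves.\<close>
  have "\<exists>f. continuous_map X euclideanreal f \<and>
      (disjnt (X closure_of b i) (X closure_of b j) \<longrightarrow>
        f ` (X closure_of b i) \<subseteq> {0} \<and> f ` (X closure_of b j) \<subseteq> {1})" for i j
  proof (cases "disjnt (X closure_of b i) (X closure_of b j)")
    case True
    show ?thesis
      by (rule Urysohn_lemma_alt[OF normal closedin_closure_of closedin_closure_of True, where a = 0 and b = 1])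
        blast
  next
    case False
    then show ?thesis
      by (intro exI[of _ "\<lambda>_. 0"]) auto
  qed
  then obtain f where cont: "\<And>i j. continuous_map X euclideanreal (f i j)"
    and f: "\<And>i j. disjnt (X closure_of b i) (X closure_of b j) \<Longrightarrow>
        f i j ` (X closure_of b i) \<subseteq> {0 :: real} \<and> f i j ` (X closure_of b j) \<subseteq> {1}"
    by metis
  \<comment> \<open>Coding pairs by \<open>prod_decode\<close> gives values in
    \<open>nat \<Rightarrow> real\<close>, a metrizable type whose topology is the product
    topology.\<close>
  define F where "F = (\<lambda>x n. f (fst (prod_decode n)) (snd (prod_decode n)) x)"
  have "continuous_map X euclidean F"
    unfolding euclidean_product_topology[symmetric] F_def continuous_map_componentwise_UNIV
    using cont by simp
  moreover have "inj_on F (topspace X)"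
  proof (rule inj_onI, rule ccontr)
    fix x y assume x: "x \<in> topspace X" and y: "y \<in> topspace X" and eq: "F x = F y" and "x \<noteq> y"
    then obtain U V where U: "openin X U" "x \<in> U" and V: "openin X V" "y \<in> V" and "disjnt U V"
      using assms(2) unfolding Hausdorff_space_def by metis
    have nbh: "\<exists>i. z \<in> b i \<and> X closure_of b i \<subseteq> W" if W: "openin X W" "z \<in> W" for z W
    proof -
      obtain W' C where W': "openin X W'" "z \<in> W'" and "closedin X C" "W' \<subseteq> C" "C \<subseteq> W"
        using W neighbourhood_base_of_closedin[THEN iffD2, OF reg, unfolded neighbourhood_base_of] by meson
      moreover obtain i where "z \<in> b i" "b i \<subseteq> W'"
        by (metis (no_types, lifting) W' b base insertI2 rangeE)
      ultimately show ?thesis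
        by (meson closure_of_minimal order_trans)
    qed
    obtain i j where i: "x \<in> b i" "X closure_of b i \<subseteq> U" and j: "y \<in> b j" "X closure_of b j \<subseteq> V"
      using nbh U V by metis
    have "disjnt (X closure_of b i) (X closure_of b j)"
      using \<open>disjnt U V\<close> i j by (meson disjnt_subset1 disjnt_subset2)
    moreover have "x \<in> X closure_of b i" "y \<in> X closure_of b j"
      using i(1) j(1) x y by (auto simp: in_closure_of)
    ultimately have "f i j x = 0" "f i j y = 1"
      using f by blast+
    moreover have "f i j x = f i j y"
      using fun_cong[OF eq, of "prod_encode (i, j)"] by (simp add: F_def)
    ultimately show False
      by simp
  qed
  ultimately have "embedding_map X euclidean F"
    by (intro continuous_imp_embedding_map assms(1)) (auto simp: Hausdorff_space_euclidean)
  then have "X homeomorphic_space subtopology euclidean (F ` topspace X)"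
    by (rule embedding_map_imp_homeomorphic_space)
  then show ?thesis
    by (simp add: homeomorphic_metrizable_space metrizable_space_subtopology metrizable_space_euclidean)
qed

section \<open>Minimal selectors\<close>

text \<open>Unlike a thread, such a set may have several elements on one level. It replaces
  selectors, whose definition through caps is harder to handle: both notions have the same minimal
  members.\<close>

definition threadlike :: "(nat \<Rightarrow> 'a graph) \<Rightarrow> (nat \<Rightarrow> nat \<Rightarrow> ('a \<times> 'a) set) \<Rightarrow> (nat \<times> 'a) set \<Rightarrow> bool" where
  "threadlike G R S \<longleftrightarrow> S \<subseteq> ind_poset G \<and>
     (\<forall>p q. p \<in> S \<and> (p, q) \<in> ind_order G R \<longrightarrow> q \<in> S) \<and> (\<forall>n. \<exists>g. (n, g) \<in> S)"

text \<open>The spectrum depends on the sequence alone, so the ambient category is taken to be all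
  of \<open>cat_B\<close>.\<close>

locale graph_seq =
  fixes G :: "nat \<Rightarrow> 'a graph" and R :: "nat \<Rightarrow> nat \<Rightarrow> ('a \<times> 'a) set"
  assumes seq: "sequence_in cat_B G R"
begin

lemma graph: "is_graph (G n)"
  using seq by (auto simp: sequence_in_def cat_B_def)

lemma finite_verts: "finite (verts (G n))"
  using graph by (auto simp: is_graph_def)

lemma edge_refl: "g \<in> verts (G n) \<Longrightarrow> (g, g) \<in> edges (G n)"
  using graph[of n] by (auto simp: is_graph_def refl_on_def)

lemma edge_sym: "(g, h) \<in> edges (G n) \<Longrightarrow> (h, g) \<in> edges (G n)"
  using graph[of n] by (auto simp: is_graph_def sym_def)

lemma R_verts: "m \<le> n \<Longrightarrow> (h, g) \<in> R m n \<Longrightarrow> h \<in> verts (G m) \<and> g \<in> verts (G n)"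
  using seq unfolding sequence_in_def cat_B_def by fastforce

lemma R_refl: "(h, g) \<in> R n n \<longleftrightarrow> h = g \<and> g \<in> verts (G n)"
  using seq by (auto simp: sequence_in_def)

lemma R_comp: "l \<le> m \<Longrightarrow> m \<le> n \<Longrightarrow> R l m O R m n = R l n"
  using seq by (auto simp: sequence_in_def)

lemma R_trans: "l \<le> m \<Longrightarrow> m \<le> n \<Longrightarrow> (x, y) \<in> R l m \<Longrightarrow> (y, z) \<in> R m n \<Longrightarrow> (x, z) \<in> R l n"
  using R_comp by blast

lemma R_edge:
  assumes "m \<le> n" "(h, g) \<in> R m n" "(h', g') \<in> R m n" "(g, g') \<in> edges (G n)"
  shows "(h, h') \<in> edges (G m)"
proof -
  have "edge_preserving (G n) (G m) (R m n)"
    using seq assms(1) by (auto simp: sequence_in_def cat_B_def)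
  then show ?thesis
    using assms(2-4) unfolding edge_preserving_def by blast
qed

lemma ex_above: 
  assumes "m \<le> n" "g \<in> verts (G n)"
  shows "\<exists>h. (h, g) \<in> R m n"
proof -
  have "co_surjective (G n) (G m) (R m n)"
    using seq assms(1) by (auto simp: sequence_in_def cat_B_def co_bijective_def)
  then show ?thesis
    using assms(2) unfolding co_surjective_def by blast
qed

lemma ex_below:
  assumes "m \<le> n" "h \<in> verts (G m)"
  shows "\<exists>g. (h, g) \<in> R m n"
proof -
  have "co_injective (G n) (G m) (R m n)"
    using seq assms(1) by (auto simp: sequence_in_def cat_B_def co_bijective_def)
  then show ?thesis
    using assms(2) unfolding co_injective_def by blast
qed

lemma poset_iff: "(n, g) \<in> ind_poset G \<longleftrightarrow> g \<in> verts (G n)"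
  by (auto simp: ind_poset_def)

lemma order_iff: "((n, p), (m, q)) \<in> ind_order G R \<longleftrightarrow> m \<le> n \<and> (q, p) \<in> R m n"
  using R_verts by (auto simp: ind_order_def)

lemma order_poset: "(p, q) \<in> ind_order G R \<Longrightarrow> p \<in> ind_poset G \<and> q \<in> ind_poset G"
  by (auto simp: ind_order_def ind_poset_def)

lemma order_refl: "p \<in> ind_poset G \<Longrightarrow> (p, p) \<in> ind_order G R"
  by (cases p) (auto simp: poset_iff order_iff R_refl)

lemma order_trans: "(p, q) \<in> ind_order G R \<Longrightarrow> (q, r) \<in> ind_order G R \<Longrightarrow> (p, r) \<in> ind_order G R"
  by (cases p; cases q; cases r) (auto simp: order_iff intro: R_trans)

text \<open>Levels suffice as bands. A band is finite, hence refined by every level of larger index;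
  conversely each level is a band, by co-surjectivity for later elements and co-injectivity for
  earlier ones.\<close>

lemma is_cap_iff:
  "is_cap (ind_poset G) (ind_order G R) K \<longleftrightarrow>
     K \<subseteq> ind_poset G \<and> (\<exists>n. \<forall>g\<in>verts (G n). \<exists>c\<in>K. ((n, g), c) \<in> ind_order G R)"
    (is "?lhs \<longleftrightarrow> ?rhs")
proof
  assume ?lhs
  then obtain B where K: "K \<subseteq> ind_poset G" and B: "is_band (ind_poset G) (ind_order G R) B"
    and BK: "\<And>b. b \<in> B \<Longrightarrow> \<exists>c\<in>K. (b, c) \<in> ind_order G R"
    unfolding is_cap_def by blast
  from B have "finite B"
    by (simp add: is_band_def)
  then obtain n where n: "\<And>b. b \<in> B \<Longrightarrow> fst b < n"
    by (metis finite_imageI finite_nat_set_iff_bounded imageI)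
  have "\<exists>c\<in>K. ((n, g), c) \<in> ind_order G R" if g: "g \<in> verts (G n)" for g
  proof -
    obtain b where b: "b \<in> B" "((n, g), b) \<in> ind_order G R \<or> (b, (n, g)) \<in> ind_order G R"
      using B g unfolding is_band_def by (metis poset_iff)
    \<comment> \<open>The other comparison is impossible, since the index of \<open>b\<close> is
      smaller than \<open>n\<close>.\<close>
    have "((n, g), b) \<in> ind_order G R"
      using b n[OF b(1)] by (cases b) (auto simp: order_iff)
    then show ?thesis
      using BK[OF b(1)] order_trans by blast
  qed
  with K show ?rhs
    by blast
next
  assume ?rhs
  then obtain n where K: "K \<subseteq> ind_poset G"
    and n: "\<And>g. g \<in> verts (G n) \<Longrightarrow> \<exists>c\<in>K. ((n, g), c) \<in> ind_order G R"
    by blast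
  have "\<exists>b\<in>{n} \<times> verts (G n). (p, b) \<in> ind_order G R \<or> (b, p) \<in> ind_order G R"
    if pP: "p \<in> ind_poset G" for p
  proof -
    obtain k x where p: "p = (k, x)" and x: "x \<in> verts (G k)"
      using pP by (cases p) (auto simp: poset_iff)
    show ?thesis
    proof (cases "n \<le> k")
      case True
      then obtain h where "(h, x) \<in> R n k"
        using x ex_above by blast
      then show ?thesis
        using True R_verts by (auto simp: p order_iff)
    next
      case False
      then obtain h where "(x, h) \<in> R k n"
        using x ex_below[of k n x] by auto
      then show ?thesis
        using False R_verts[of k n] by (auto simp: p order_iff)
    qed
  qed
  then have "is_band (ind_poset G) (ind_order G R) ({n} \<times> verts (G n))"
    by (auto simp: is_band_def finite_verts poset_iff)
  moreover have "\<exists>c\<in>K. (b, c) \<in> ind_order G R" if "b \<in> {n} \<times> verts (G n)" for b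
    using that n by auto
  ultimately show ?lhs
    unfolding is_cap_def using K by blast
qed

lemma selector_if_threadlike:
  assumes "threadlike G R S"
  shows "is_selector (ind_poset G) (ind_order G R) S"
  unfolding is_selector_def
proof (intro conjI allI impI)
  show sub: "S \<subseteq> ind_poset G"
    using assms by (simp add: threadlike_def)
  fix K assume "is_cap (ind_poset G) (ind_order G R) K"
  then obtain n where n: "\<And>g. g \<in> verts (G n) \<Longrightarrow> \<exists>c\<in>K. ((n, g), c) \<in> ind_order G R"
    unfolding is_cap_iff by blast
  obtain g where g: "(n, g) \<in> S"
    using assms unfolding threadlike_def by blast
  then obtain c where "c \<in> K" "((n, g), c) \<in> ind_order G R"
    using n sub by (meson poset_iff subsetD)
  then show "S \<inter> K \<noteq> {}"
    using assms g unfolding threadlike_def by blast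
qed

text \<open>If the core of \<open>S\<close> missed level \<open>n\<close>, every vertex of that
  level would lie below some element outside \<open>S\<close>. The complement of \<open>S\<close>
  would then be a cap, which the selector \<open>S\<close> would have to meet.\<close>

lemma threadlike_core:
  assumes S: "is_selector (ind_poset G) (ind_order G R) S"
  shows "threadlike G R {p \<in> S. \<forall>q. (p, q) \<in> ind_order G R \<longrightarrow> q \<in> S}"
  unfolding threadlike_def
proof (intro conjI allI impI)
  fix n
  show "\<exists>g. (n, g) \<in> {p \<in> S. \<forall>q. (p, q) \<in> ind_order G R \<longrightarrow> q \<in> S}"
  proof (rule ccontr)
    assume *: "\<not> ?thesis"
    have "\<exists>c\<in>ind_poset G - S. ((n, g), c) \<in> ind_order G R" if "g \<in> verts (G n)" for g
    proof (cases "(n, g) \<in> S")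
      case True
      then show ?thesis
        using * order_poset by blast
    next
      case False
      then show ?thesis
        using that order_refl poset_iff by blast
    qed
    then have "is_cap (ind_poset G) (ind_order G R) (ind_poset G - S)"
      unfolding is_cap_iff by blast
    then show False
      using S unfolding is_selector_def by blast
  qed
next
  fix p q assume "p \<in> {p \<in> S. \<forall>q. (p, q) \<in> ind_order G R \<longrightarrow> q \<in> S} \<and> (p, q) \<in> ind_order G R"
  then show "q \<in> {p \<in> S. \<forall>q. (p, q) \<in> ind_order G R \<longrightarrow> q \<in> S}"
    using order_trans by blast
qed (use S in \<open>auto simp: is_selector_def\<close>)

text \<open>Threadlike sets are selectors, and every selector contains a threadlike set, namely its
  core. Hence the minimal members agree.\<close>

lemma spectrum_eq_minimal_threadlike:
  "S \<in> spectrum (ind_poset G) (ind_order G R) \<longleftrightarrow>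
     threadlike G R S \<and> (\<forall>T. threadlike G R T \<and> T \<subseteq> S \<longrightarrow> T = S)" (is "?lhs \<longleftrightarrow> ?rhs")
proof
  assume L: ?lhs
  let ?T = "{p \<in> S. \<forall>q. (p, q) \<in> ind_order G R \<longrightarrow> q \<in> S}"
  have "threadlike G R ?T"
    using L by (intro threadlike_core) (simp add: spectrum_def)
  moreover from this have "?T = S"
    using L selector_if_threadlike by (auto simp: spectrum_def)
  ultimately show ?rhs
    using L selector_if_threadlike by (auto simp: spectrum_def)
next
  assume r: ?rhs
  have "T = S" if T: "is_selector (ind_poset G) (ind_order G R) T" "T \<subseteq> S" for T
    using threadlike_core[OF T(1)] T(2) r by blast
  with r show ?lhs
    by (auto simp: spectrum_def selector_if_threadlike)
qed

lemma threadlike_mono: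
  "threadlike G R S \<Longrightarrow> (n, g) \<in> S \<Longrightarrow> (h, g) \<in> R m n \<Longrightarrow> m \<le> n \<Longrightarrow> (m, h) \<in> S"
  unfolding threadlike_def using order_iff by blast

text \<open>Deleting from \<open>S\<close> everything below \<open>(n, g)\<close> leaves an
  up-closed set, which by minimality misses a level \<open>m\<close>; so all of level
  \<open>m\<close> of \<open>S\<close> lies below \<open>(n, g)\<close>. Conversely, such a level
  forces \<open>(n, g)\<close> into every threadlike subset of \<open>S\<close>.\<close>

lemma spectrum_iff:
  "S \<in> spectrum (ind_poset G) (ind_order G R) \<longleftrightarrow>
     threadlike G R S \<and>
     (\<forall>n g. (n, g) \<in> S \<longrightarrow> (\<exists>m\<ge>n. \<forall>h. (m, h) \<in> S \<longrightarrow> (g, h) \<in> R n m))" (is "?lhs \<longleftrightarrow> ?rhs")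
proof
  assume L: ?lhs
  then have S: "threadlike G R S"
    by (simp add: spectrum_eq_minimal_threadlike)
  have "\<exists>m\<ge>n. \<forall>h. (m, h) \<in> S \<longrightarrow> (g, h) \<in> R n m" if ng: "(n, g) \<in> S" for n g
  proof -
    let ?T = "{p \<in> S. (p, (n, g)) \<notin> ind_order G R}"
    have "(n, g) \<notin> ?T"
      using S ng order_refl by (auto simp: threadlike_def)
    with ng have "?T \<noteq> S"
      by blast
    then have "\<not> threadlike G R ?T"
      using L unfolding spectrum_eq_minimal_threadlike by blast
    moreover have "?T \<subseteq> ind_poset G \<and> (\<forall>p q. p \<in> ?T \<and> (p, q) \<in> ind_order G R \<longrightarrow> q \<in> ?T)"
      using S order_trans unfolding threadlike_def by blast
    ultimately obtain m where m: "\<And>h. (m, h) \<in> S \<Longrightarrow> ((m, h), (n, g)) \<in> ind_order G R"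
      unfolding threadlike_def by blast
    then show ?thesis
      using S unfolding order_iff threadlike_def by blast
  qed
  with S show ?rhs
    by blast
next
  assume r: ?rhs
  have "S \<subseteq> T" if T: "threadlike G R T" "T \<subseteq> S" for T
  proof
    fix p assume "p \<in> S"
    moreover obtain n g where p: "p = (n, g)"
      by (cases p)
    ultimately obtain m where m: "m \<ge> n" "\<And>h. (m, h) \<in> S \<Longrightarrow> (g, h) \<in> R n m"
      using r by blast
    obtain h where h: "(m, h) \<in> T"
      using T(1) unfolding threadlike_def by blast
    then have "(g, h) \<in> R n m"
      using m(2) T(2) by blast
    then show "p \<in> T"
      unfolding p using threadlike_mono[OF T(1) h] m(1) by blast
  qed
  with r show ?lhs
    unfolding spectrum_eq_minimal_threadlike by blast
qed

lemma spectrum_threadlike: "S \<in> spectrum (ind_poset G) (ind_order G R) \<Longrightarrow> threadlike G R S"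
  by (simp add: spectrum_iff)

text \<open>By up-closure the level found in \<open>spectrum_iff\<close> can be replaced by any
  later one. This allows one level to be chosen for several elements of \<open>S\<close> at
  once.\<close>

lemma spectrum_shrink:
  assumes S: "S \<in> spectrum (ind_poset G) (ind_order G R)" and "(n, g) \<in> S"
  obtains m where "m \<ge> n" and "\<And>k h. k \<ge> m \<Longrightarrow> (k, h) \<in> S \<Longrightarrow> (g, h) \<in> R n k"
proof -
  obtain m where m: "m \<ge> n" "\<And>h. (m, h) \<in> S \<Longrightarrow> (g, h) \<in> R n m"
    using assms unfolding spectrum_iff by blast
  have "(g, h) \<in> R n k" if k: "k \<ge> m" "(k, h) \<in> S" for k h
  proof -
    have S': "threadlike G R S"
      by (rule spectrum_threadlike[OF S])
    then have "h \<in> verts (G k)"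
      using k(2) unfolding threadlike_def by (auto simp: poset_iff)
    then obtain h' where h': "(h', h) \<in> R m k"
      using ex_above k(1) by blast
    then have "(m, h') \<in> S"
      using threadlike_mono S' k by blast
    then show ?thesis
      using m h' k(1) R_trans by blast
  qed
  then show ?thesis
    using that m(1) by blast
qed

text \<open>Zorn's lemma applies because the levels are finite, so that the intersection of a chain
  still meets each of them.\<close>

lemma ex_spectrum_subset:
  assumes S: "threadlike G R S"
  shows "\<exists>T\<in>spectrum (ind_poset G) (ind_order G R). T \<subseteq> S"
proof -
  let ?A = "{T. threadlike G R T \<and> T \<subseteq> S}"
  \<comment> \<open>The order is reverse inclusion, so a maximal element is a minimal threadlike
    set.\<close>
  have "\<exists>M\<in>?A. \<forall>T\<in>?A. T \<subseteq> M \<longrightarrow> T = M"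
  proof (rule predicate_Zorn)
    show "partial_order_on ?A (relation_of (\<lambda>x y. y \<subseteq> x) ?A)"
      by (auto simp: partial_order_on_def preorder_on_def refl_on_def trans_def antisym_def relation_of_def)
  next
    fix C assume "C \<in> Chains (relation_of (\<lambda>x y. y \<subseteq> x) ?A)"
    then have CA: "C \<subseteq> ?A" and chain: "\<And>x y. x \<in> C \<Longrightarrow> y \<in> C \<Longrightarrow> x \<subseteq> y \<or> y \<subseteq> x"
      by (auto simp: Chains_def relation_of_def)
    show "\<exists>u\<in>?A. \<forall>a\<in>C. u \<subseteq> a"
    proof (cases "C = {}")
      case True
      then show ?thesis using S by blast
    next
      case False
      have "\<exists>g. (n, g) \<in> \<Inter>C" for n
      proof -
        let ?L = "\<lambda>T. {g. (n, g) \<in> T}"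
        \<comment> \<open>A member of the chain with the fewest elements on level \<open>n\<close>
          has its level \<open>n\<close> contained in that of every other member.\<close>
        obtain T0 where T0: "T0 \<in> C" "\<And>T. T \<in> C \<Longrightarrow> card (?L T0) \<le> card (?L T)"
          using ex_has_least_nat[of "\<lambda>T. T \<in> C" _ "\<lambda>T. card (?L T)"] False by (metis ex_in_conv)
        have fin: "finite (?L T)" if "T \<in> C" for T
        proof (rule finite_subset)
          show "?L T \<subseteq> verts (G n)"
            using that CA unfolding threadlike_def by (blast dest: poset_iff[THEN iffD1])
        qed (rule finite_verts)
        have "?L T0 \<subseteq> ?L T" if T: "T \<in> C" for T
        proof (cases "T0 \<subseteq> T")
          case False
          then have "?L T \<subseteq> ?L T0"
            using chain T T0(1) by blast
          then have "?L T = ?L T0"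
            by (rule card_seteq[OF fin[OF T0(1)] _ T0(2)[OF T]])
          then show ?thesis by simp
        qed blast
        moreover obtain g where "(n, g) \<in> T0"
          using T0(1) CA unfolding threadlike_def by blast
        ultimately show ?thesis
          by blast
      qed
      moreover have "\<Inter>C \<subseteq> S" "\<Inter>C \<subseteq> ind_poset G"
        using CA False unfolding threadlike_def by blast+
      moreover have "q \<in> \<Inter>C" if "p \<in> \<Inter>C" "(p, q) \<in> ind_order G R" for p q
        using that CA unfolding threadlike_def by blast
      ultimately have "\<Inter>C \<in> ?A"
        unfolding threadlike_def by blast
      then show ?thesis
        by blast
    qed
  qed
  then obtain M where M: "threadlike G R M" "M \<subseteq> S"
    and min: "\<And>T. threadlike G R T \<Longrightarrow> T \<subseteq> S \<Longrightarrow> T \<subseteq> M \<Longrightarrow> T = M"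
    by blast
  have "M \<in> spectrum (ind_poset G) (ind_order G R)"
    unfolding spectrum_eq_minimal_threadlike using M min by blast
  with M(2) show ?thesis
    by blast
qed

end

section \<open>The topology of the spectrum\<close>

context graph_seq
begin

lemma topspace_seq_spectrum: "topspace (seq_spectrum G R) = spectrum (ind_poset G) (ind_order G R)"
  by (auto simp: seq_spectrum_def spectrum_top_def)

lemma openin_seq_spectrum_basic:
  "openin (seq_spectrum G R) {S \<in> spectrum (ind_poset G) (ind_order G R). p \<in> S}"
proof (cases "p \<in> ind_poset G")
  case True
  then show ?thesis
    unfolding seq_spectrum_def spectrum_top_def by (auto intro: topology_generated_by_Basis)
next
  case False
  then have "{S \<in> spectrum (ind_poset G) (ind_order G R). p \<in> S} = {}"
    using spectrum_threadlike unfolding threadlike_def by blast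
  then show ?thesis
    by (simp only: openin_empty)
qed

text \<open>The subbasic sets already form a base: given two elements of \<open>S\<close>, all
  sufficiently late elements of \<open>S\<close> lie below both, and the basic set of such an
  element lies in the intersection.\<close>

lemma seq_spectrum_base:
  assumes "openin (seq_spectrum G R) U" and "S \<in> U"
  obtains p where "p \<in> S" and "{T \<in> spectrum (ind_poset G) (ind_order G R). p \<in> T} \<subseteq> U"
proof -
  let ?X = "spectrum (ind_poset G) (ind_order G R)"
  have "generate_topology_on (insert ?X ((\<lambda>p. {S \<in> ?X. p \<in> S}) ` ind_poset G)) U"
    using assms(1) unfolding seq_spectrum_def spectrum_top_def by (rule openin_topology_generated_by)
  moreover have "S \<in> ?X"
    using assms openin_subset topspace_seq_spectrum by blast
  ultimately have "\<exists>p\<in>S. {T \<in> ?X. p \<in> T} \<subseteq> U"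
    using assms(2)
  proof induction
    case (Int U V)
    from Int.IH(1)[OF Int.prems(1)] Int.prems(2)
    obtain n g where g: "(n, g) \<in> S" "{T \<in> ?X. (n, g) \<in> T} \<subseteq> U"
      by auto
    from Int.IH(2)[OF Int.prems(1)] Int.prems(2)
    obtain m h where h: "(m, h) \<in> S" "{T \<in> ?X. (m, h) \<in> T} \<subseteq> V"
      by auto
    obtain n' where n': "n' \<ge> n" "\<And>k x. k \<ge> n' \<Longrightarrow> (k, x) \<in> S \<Longrightarrow> (g, x) \<in> R n k"
      by (rule spectrum_shrink[OF Int.prems(1) g(1)]) blast
    obtain m' where m': "m' \<ge> m" "\<And>k x. k \<ge> m' \<Longrightarrow> (k, x) \<in> S \<Longrightarrow> (h, x) \<in> R m k"
      by (rule spectrum_shrink[OF Int.prems(1) h(1)]) blast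
    define k where "k = max n' m'"
    obtain x where x: "(k, x) \<in> S"
      using spectrum_threadlike[OF Int.prems(1)] unfolding threadlike_def by blast
    have k: "n' \<le> k" "m' \<le> k"
      by (auto simp: k_def)
    have "{T \<in> ?X. (k, x) \<in> T} \<subseteq> {T \<in> ?X. (n, g) \<in> T} \<inter> {T \<in> ?X. (m, h) \<in> T}"
      using threadlike_mono[OF spectrum_threadlike] n'(2)[OF k(1) x] m'(2)[OF k(2) x] n'(1) m'(1) k
      by (auto dest: le_trans)
    with x g(2) h(2) show ?case
      by blast
  next
    case (UN K)
    from UN.prems(2) obtain V where V: "V \<in> K" "S \<in> V"
      by blast
    from UN.IH[OF V(1) UN.prems(1) V(2)] V(1) show ?case
      by blast
  next
    case (Basis V)
    obtain p where "p \<in> S"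
      using spectrum_threadlike[OF Basis.prems(1)] unfolding threadlike_def by blast
    with Basis show ?case
      by auto
  qed simp
  then show ?thesis
    using that by blast
qed

text \<open>The elements whose basic set fits into no member of the cover form an up-closed set. If
  it met every level, it would contain a minimal selector, which has a basic neighbourhood inside a
  member of the cover. So some finite level consists of small elements and yields a finite
  subcover.\<close>

lemma compact_seq_spectrum: "compact_space (seq_spectrum G R)"
  unfolding compact_space_alt
proof (intro allI impI)
  let ?X = "spectrum (ind_poset G) (ind_order G R)"
  fix \<U> assume \<U>: "Ball \<U> (openin (seq_spectrum G R)) \<and> topspace (seq_spectrum G R) \<subseteq> \<Union> \<U>"
  define small where "small p \<longleftrightarrow> (\<exists>U\<in>\<U>. {T \<in> ?X. p \<in> T} \<subseteq> U)" for p
  let ?A = "{p \<in> ind_poset G. \<not> small p}"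
  have "\<exists>n. \<forall>g\<in>verts (G n). small (n, g)"
  proof (rule ccontr)
    assume no_level: "\<not> ?thesis"
    have "q \<in> ?A" if p: "p \<in> ?A" "(p, q) \<in> ind_order G R" for p q
    proof -
      have "{T \<in> ?X. p \<in> T} \<subseteq> {T \<in> ?X. q \<in> T}"
        using p(2) spectrum_threadlike unfolding threadlike_def by blast
      then show ?thesis
        using p order_poset unfolding small_def by blast
    qed
    moreover have "\<exists>g. (n, g) \<in> ?A" for n
    proof -
      obtain g where "g \<in> verts (G n)" "\<not> small (n, g)"
        using no_level by blast
      then show ?thesis
        using poset_iff by auto
    qed
    ultimately have "threadlike G R ?A"
      unfolding threadlike_def by blast
    then obtain S where S: "S \<in> ?X" "S \<subseteq> ?A"
      using ex_spectrum_subset by blast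
    then obtain U where U: "U \<in> \<U>" "S \<in> U"
      using \<U> topspace_seq_spectrum by blast
    with \<U> have "openin (seq_spectrum G R) U"
      by blast
    from seq_spectrum_base[OF this U(2)] obtain p where "p \<in> S" "{T \<in> ?X. p \<in> T} \<subseteq> U" .
    with S(2) U(1) show False
      unfolding small_def by blast
  qed
  then obtain n where "\<forall>g\<in>verts (G n). \<exists>U\<in>\<U>. {T \<in> ?X. (n, g) \<in> T} \<subseteq> U"
    unfolding small_def ..
  then obtain f where f: "\<forall>g\<in>verts (G n). f g \<in> \<U> \<and> {T \<in> ?X. (n, g) \<in> T} \<subseteq> f g"
    by metis
  have "topspace (seq_spectrum G R) \<subseteq> \<Union> (f ` verts (G n))"
  proof
    fix S assume "S \<in> topspace (seq_spectrum G R)"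
    then have S: "S \<in> ?X"
      by (simp add: topspace_seq_spectrum)
    then obtain g where "(n, g) \<in> S" "g \<in> verts (G n)"
      using spectrum_threadlike[OF S] poset_iff unfolding threadlike_def by blast
    with S f show "S \<in> \<Union> (f ` verts (G n))"
      by blast
  qed
  then show "\<exists>\<F>. finite \<F> \<and> \<F> \<subseteq> \<U> \<and> topspace (seq_spectrum G R) \<subseteq> \<Union> \<F>"
    using f finite_verts by (intro exI[of _ "f ` verts (G n)"]) auto
qed

lemma second_countable_seq_spectrum: "second_countable (seq_spectrum G R)"
  unfolding second_countable_def
proof (intro exI conjI allI impI)
  let ?b = "\<lambda>p. {S \<in> spectrum (ind_poset G) (ind_order G R). p \<in> S}"
  show "countable (?b ` ind_poset G)"
    unfolding ind_poset_def
    by (intro countable_image countable_SIGMA countable_finite[OF finite_verts]) simp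
  show "\<forall>V\<in>?b ` ind_poset G. openin (seq_spectrum G R) V"
    using openin_seq_spectrum_basic by blast
  fix U S assume US: "openin (seq_spectrum G R) U \<and> S \<in> U"
  then obtain p where p: "p \<in> S" "?b p \<subseteq> U"
    using seq_spectrum_base by metis
  moreover have "S \<in> spectrum (ind_poset G) (ind_order G R)"
    using US openin_subset topspace_seq_spectrum by blast
  moreover from this have "p \<in> ind_poset G"
    using spectrum_threadlike p(1) unfolding threadlike_def by blast
  ultimately show "\<exists>V\<in>?b ` ind_poset G. S \<in> V \<and> V \<subseteq> U"
    by blast
qed

text \<open>A late element of \<open>S\<close> lies below both \<open>g\<close> and
  \<open>h\<close>, and its loop is mapped to an edge between them.\<close>

lemma spectrum_clique:
  assumes S: "S \<in> spectrum (ind_poset G) (ind_order G R)" and g: "(n, g) \<in> S" and h: "(n, h) \<in> S"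
  shows "(g, h) \<in> edges (G n)"
proof -
  obtain i where i: "i \<ge> n" "\<And>k x. k \<ge> i \<Longrightarrow> (k, x) \<in> S \<Longrightarrow> (g, x) \<in> R n k"
    by (rule spectrum_shrink[OF S g]) blast
  obtain j where j: "j \<ge> n" "\<And>k x. k \<ge> j \<Longrightarrow> (k, x) \<in> S \<Longrightarrow> (h, x) \<in> R n k"
    by (rule spectrum_shrink[OF S h]) blast
  obtain x where x: "(max i j, x) \<in> S"
    using spectrum_threadlike[OF S] unfolding threadlike_def by blast
  have "n \<le> max i j" "(g, x) \<in> R n (max i j)" "(h, x) \<in> R n (max i j)"
    using i j x by auto
  moreover have "x \<in> verts (G (max i j))"
    using R_verts calculation(1,2) by blast
  ultimately show ?thesis
    using R_edge edge_refl by blast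
qed

end

section \<open>Separation of points: Hausdorff and metrizable spectra\<close>

locale star_seq = graph_seq +
  assumes star: "\<exists>k\<ge>m. star_refining (G k) (G m) (R m k)"
begin

text \<open>Take an element of \<open>S\<close> outside \<open>T\<close>, a level \<open>m\<close>
  of \<open>S\<close> lying below it, and a level \<open>k\<close> that star-refines
  \<open>m\<close>. Adjacent elements of \<open>S\<close> and \<open>T\<close> on level
  \<open>k\<close> would have a common upper bound on level \<open>m\<close>, and this would push
  the chosen element into \<open>T\<close>.\<close>

lemma spectrum_separated:
  assumes S: "S \<in> spectrum (ind_poset G) (ind_order G R)"
    and T: "T \<in> spectrum (ind_poset G) (ind_order G R)" and "S \<noteq> T"
  shows "\<exists>k. \<forall>a b. (k, a) \<in> S \<and> (k, b) \<in> T \<longrightarrow> (a, b) \<notin> edges (G k)"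
proof -
  have "\<not> S \<subseteq> T"
    using assms unfolding spectrum_eq_minimal_threadlike by blast
  then obtain n s where s: "(n, s) \<in> S" "(n, s) \<notin> T"
    by auto
  obtain m where m: "m \<ge> n" "\<And>x. (m, x) \<in> S \<Longrightarrow> (s, x) \<in> R n m"
    by (rule spectrum_shrink[OF S s(1)]) blast
  obtain k where k: "k \<ge> m" "star_refining (G k) (G m) (R m k)"
    using star by blast
  have "(a, b) \<notin> edges (G k)" if a: "(k, a) \<in> S" and b: "(k, b) \<in> T" for a b
  proof
    assume ab: "(a, b) \<in> edges (G k)"
    have va: "a \<in> verts (G k)"
      using a S spectrum_threadlike poset_iff unfolding threadlike_def by blast
    then obtain h where h: "{g'. (g', a) \<in> edges (G k)} \<subseteq> R m k `` {h}"
      using k(2) unfolding star_refining_def by blast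
    have "(h, a) \<in> R m k" "(h, b) \<in> R m k"
      using h ab va edge_sym edge_refl by blast+
    then have "(m, h) \<in> S" "(m, h) \<in> T"
      using threadlike_mono spectrum_threadlike S T a b k(1) by blast+
    then have "(n, s) \<in> T"
      using m threadlike_mono spectrum_threadlike T by blast
    with s(2) show False ..
  qed
  then show ?thesis
    by blast
qed

text \<open>Non-adjacent elements of one level have disjoint basic sets, since the levels of a
  minimal selector are cliques.\<close>

lemma Hausdorff_seq_spectrum: "Hausdorff_space (seq_spectrum G R)"
  unfolding Hausdorff_space_def topspace_seq_spectrum
proof (intro allI impI)
  let ?X = "spectrum (ind_poset G) (ind_order G R)"
  fix S T assume ST: "S \<in> ?X \<and> T \<in> ?X \<and> S \<noteq> T"
  then obtain k where k: "\<And>a b. (k, a) \<in> S \<Longrightarrow> (k, b) \<in> T \<Longrightarrow> (a, b) \<notin> edges (G k)"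
    using spectrum_separated by blast
  obtain a b where ab: "(k, a) \<in> S" "(k, b) \<in> T"
    using ST spectrum_threadlike unfolding threadlike_def by blast
  have "disjnt {U \<in> ?X. (k, a) \<in> U} {U \<in> ?X. (k, b) \<in> U}"
    using k[OF ab] spectrum_clique by (auto simp: disjnt_def)
  then show "\<exists>U V. openin (seq_spectrum G R) U \<and> openin (seq_spectrum G R) V \<and> S \<in> U \<and> T \<in> V \<and> disjnt U V"
    using ST ab openin_seq_spectrum_basic by blast
qed

lemma metrizable_seq_spectrum: "metrizable_space (seq_spectrum G R)"
  by (intro metrizable_space_compact_Hausdorff_second_countable compact_seq_spectrum
      Hausdorff_seq_spectrum second_countable_seq_spectrum)

end

section \<open>Spectra of subsequences with smaller relations\<close>

text \<open>Each minimal selector of \<open>K\<close> has a unique minimal selector of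
  \<open>G\<close> containing its image. This correspondence is a continuous bijection from a
  compact space to a Hausdorff space.\<close>

lemma homeomorphic_spectrum_lax_subsequence:
  fixes G K :: "nat \<Rightarrow> 'a graph"
  assumes GR: "graph_seq G R" and KT: "star_seq K T" and \<phi>: "strict_mono \<phi>"
    and K: "\<And>n. K n = G (\<phi> n)" and T: "\<And>m n. m \<le> n \<Longrightarrow> T m n \<subseteq> R (\<phi> m) (\<phi> n)"
  shows "seq_spectrum K T homeomorphic_space seq_spectrum G R"
proof -
  interpret K: star_seq K T by fact
  interpret G: graph_seq G R by fact
  have le_\<phi>: "n \<le> \<phi> n" for n
    using \<phi> by (rule strict_mono_imp_increasing)
  have mono: "\<phi> m \<le> \<phi> n" if "m \<le> n" for m n
    using \<phi> that by (simp add: strict_mono_less_eq)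
  \<comment> \<open>Star refinement passes from \<open>T m k\<close> to the larger
    \<open>R (\<phi> m) (\<phi> k)\<close>, and on to level \<open>m\<close> by composing with
    \<open>R m (\<phi> m)\<close>.\<close>
  interpret G: star_seq G R
  proof
    fix m
    obtain k where k: "k \<ge> m" "star_refining (K k) (K m) (T m k)"
      using K.star by blast
    have "star_refining (G (\<phi> k)) (G m) (R m (\<phi> k))"
      unfolding star_refining_def
    proof
      fix g assume "g \<in> verts (G (\<phi> k))"
      then obtain h where h: "h \<in> verts (K m)" "{g'. (g', g) \<in> edges (K k)} \<subseteq> T m k `` {h}"
        using k(2) K unfolding star_refining_def by metis
      obtain h' where h': "(h', h) \<in> R m (\<phi> m)"
        using G.ex_above[OF le_\<phi>] h(1) K by metis
      have "(h', g') \<in> R m (\<phi> k)" if "(g', g) \<in> edges (G (\<phi> k))" for g'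
        using that h h' T[OF k(1)] K G.R_trans[OF le_\<phi> mono[OF k(1)]] by auto
      then show "\<exists>h\<in>verts (G m). {g'. (g', g) \<in> edges (G (\<phi> k))} \<subseteq> R m (\<phi> k) `` {h}"
        using G.R_verts[OF le_\<phi> h'] by blast
    qed
    moreover have "m \<le> \<phi> k"
      using k(1) le_\<phi> le_trans by blast
    ultimately show "\<exists>k\<ge>m. star_refining (G k) (G m) (R m k)"
      by blast
  qed
  let ?X = "spectrum (ind_poset K) (ind_order K T)" and ?Y = "spectrum (ind_poset G) (ind_order G R)"
  \<comment> \<open>Only inclusion is asked: the trace of \<open>S\<close> on the levels
    \<open>\<phi> n\<close> is threadlike for \<open>T\<close>, and a minimal selector is then
    chosen inside it.\<close>
  define sub where "sub U S \<longleftrightarrow> (\<forall>n u. (n, u) \<in> U \<longrightarrow> (\<phi> n, u) \<in> S)" for U S :: "(nat \<times> 'a) set"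
  have restrict: "\<exists>U\<in>?X. sub U S" if S: "S \<in> ?Y" for S
  proof -
    have S': "threadlike G R S"
      using S by (rule G.spectrum_threadlike)
    let ?U = "{(n, u). (\<phi> n, u) \<in> S}"
    have "threadlike K T ?U"
      unfolding threadlike_def
    proof (intro conjI allI impI)
      show "?U \<subseteq> ind_poset K"
        using S' K G.poset_iff K.poset_iff unfolding threadlike_def by fastforce
      show "\<exists>g. (n, g) \<in> ?U" for n
        using S' unfolding threadlike_def by auto
      fix p q assume "p \<in> ?U \<and> (p, q) \<in> ind_order K T"
      then show "q \<in> ?U"
        using G.threadlike_mono[OF S' _ subsetD[OF T] mono]
        by (cases p; cases q) (auto simp: K.order_iff)
    qed
    then obtain U where "U \<in> ?X" "U \<subseteq> ?U"
      using K.ex_spectrum_subset by blast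
    then show ?thesis
      unfolding sub_def by blast
  qed
  have extend: "\<exists>S\<in>?Y. sub U S" if U: "U \<in> ?X" for U
  proof -
    have U': "threadlike K T U"
      using U by (rule K.spectrum_threadlike)
    let ?S = "{p. \<exists>n u. (n, u) \<in> U \<and> ((\<phi> n, u), p) \<in> ind_order G R}"
    have "threadlike G R ?S"
      unfolding threadlike_def
    proof (intro conjI allI impI)
      show "?S \<subseteq> ind_poset G"
        using G.order_poset by blast
      show "\<exists>g. (n, g) \<in> ?S" for n
      proof -
        obtain u where u: "(n, u) \<in> U"
          using U' unfolding threadlike_def by blast
        then have "u \<in> verts (G (\<phi> n))"
          using U' K K.poset_iff unfolding threadlike_def by (metis subsetD)
        then obtain g where "(g, u) \<in> R n (\<phi> n)"
          using G.ex_above le_\<phi> by blast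
        then have "((\<phi> n, u), (n, g)) \<in> ind_order G R"
          using le_\<phi> by (simp add: G.order_iff)
        with u show ?thesis
          by blast
      qed
    next
      fix p q assume "p \<in> ?S \<and> (p, q) \<in> ind_order G R"
      then show "q \<in> ?S"
        using G.order_trans by blast
    qed
    then obtain S where S: "S \<in> ?Y" "S \<subseteq> ?S"
      using G.ex_spectrum_subset by blast
    obtain V where V: "V \<in> ?X" "sub V S"
      using restrict[OF S(1)] by blast
    \<comment> \<open>Otherwise some \<open>a\<close> in \<open>V\<close> and \<open>b\<close> in
      \<open>U\<close> on one level are not adjacent. But \<open>a\<close> lies above some
      \<open>u\<close> in \<open>U\<close>, and a late element of \<open>U\<close> lies below both
      \<open>u\<close> and \<open>b\<close>, which makes \<open>a\<close> and \<open>b\<close>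
      adjacent.\<close>
    have "V = U"
    proof (rule ccontr)
      assume "V \<noteq> U"
      then obtain k where k: "\<And>a b. (k, a) \<in> V \<Longrightarrow> (k, b) \<in> U \<Longrightarrow> (a, b) \<notin> edges (K k)"
        using K.spectrum_separated[OF V(1) U] by blast
      obtain a b where a: "(k, a) \<in> V" and b: "(k, b) \<in> U"
        using U' K.spectrum_threadlike[OF V(1)] unfolding threadlike_def by blast
      then have "(\<phi> k, a) \<in> ?S"
        using V(2) S(2) unfolding sub_def by blast
      then obtain n u where u: "(n, u) \<in> U" "\<phi> k \<le> \<phi> n" "(a, u) \<in> R (\<phi> k) (\<phi> n)"
        by (auto simp: G.order_iff)
      obtain i where i: "i \<ge> n" "\<And>j x. j \<ge> i \<Longrightarrow> (j, x) \<in> U \<Longrightarrow> (u, x) \<in> T n j"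
        by (rule K.spectrum_shrink[OF U u(1)]) blast
      obtain l where l: "l \<ge> k" "\<And>j x. j \<ge> l \<Longrightarrow> (j, x) \<in> U \<Longrightarrow> (b, x) \<in> T k j"
        by (rule K.spectrum_shrink[OF U b]) blast
      define j where "j = max i l"
      have j: "i \<le> j" "l \<le> j" "n \<le> j" "k \<le> j"
        using i(1) l(1) by (auto simp: j_def)
      obtain x where x: "(j, x) \<in> U"
        using U' unfolding threadlike_def by blast
      have "(u, x) \<in> R (\<phi> n) (\<phi> j)" and bx: "(b, x) \<in> R (\<phi> k) (\<phi> j)"
        using i(2)[OF j(1) x] l(2)[OF j(2) x] T[OF j(3)] T[OF j(4)] by blast+
      then have "(a, x) \<in> R (\<phi> k) (\<phi> j)"
        using G.R_trans[OF u(2) mono[OF j(3)] u(3)] by blast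
      moreover have "(x, x) \<in> edges (G (\<phi> j))"
        using G.R_verts[OF mono[OF j(4)] bx] G.edge_refl by blast
      ultimately have "(a, b) \<in> edges (K k)"
        using G.R_edge[OF mono[OF j(4)] _ bx] K by simp
      with k[OF a b] show False ..
    qed
    with S(1) V(2) show ?thesis
      by blast
  qed
  then obtain \<Psi> where \<Psi>: "\<And>U. U \<in> ?X \<Longrightarrow> \<Psi> U \<in> ?Y" "\<And>U. U \<in> ?X \<Longrightarrow> sub U (\<Psi> U)"
    by metis
  \<comment> \<open>Both selectors contain an element of level \<open>\<phi> k\<close>, hence also a
    common element of level \<open>k\<close> above it, against separation at level
    \<open>k\<close>.\<close>
  have unique: "S = S'" if S: "S \<in> ?Y" "S' \<in> ?Y" "U \<in> ?X" "sub U S" "sub U S'" for S S' U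
  proof (rule ccontr)
    assume "S \<noteq> S'"
    then obtain k where k: "\<And>a b. (k, a) \<in> S \<Longrightarrow> (k, b) \<in> S' \<Longrightarrow> (a, b) \<notin> edges (G k)"
      using G.spectrum_separated[OF S(1,2)] by blast
    obtain u where "(k, u) \<in> U"
      using K.spectrum_threadlike[OF S(3)] unfolding threadlike_def by blast
    then have u: "(\<phi> k, u) \<in> S" "(\<phi> k, u) \<in> S'"
      using S(4,5) unfolding sub_def by blast+
    then have "u \<in> verts (G (\<phi> k))"
      using G.spectrum_threadlike[OF S(1)] G.poset_iff unfolding threadlike_def by blast
    then obtain h where h: "(h, u) \<in> R k (\<phi> k)"
      using G.ex_above le_\<phi> by blast
    then have "(k, h) \<in> S" "(k, h) \<in> S'"
      using G.threadlike_mono G.spectrum_threadlike S(1,2) u le_\<phi> by blast+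
    moreover have "(h, h) \<in> edges (G k)"
      using G.R_verts[OF le_\<phi> h] G.edge_refl by blast
    ultimately show False
      using k by blast
  qed
  have "continuous_map (seq_spectrum K T) (seq_spectrum G R) \<Psi>"
    unfolding continuous_map_def K.topspace_seq_spectrum G.topspace_seq_spectrum
  proof (intro conjI allI impI)
    show "\<Psi> \<in> ?X \<rightarrow> ?Y"
      using \<Psi>(1) by blast
    fix V assume V: "openin (seq_spectrum G R) V"
    show "openin (seq_spectrum K T) {U \<in> ?X. \<Psi> U \<in> V}"
    proof (subst openin_subopen, intro ballI)
      fix U assume "U \<in> {U \<in> ?X. \<Psi> U \<in> V}"
      then have U: "U \<in> ?X" "\<Psi> U \<in> V"
        by auto
      obtain n g where g: "(n, g) \<in> \<Psi> U" "{S \<in> ?Y. (n, g) \<in> S} \<subseteq> V"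
        using G.seq_spectrum_base[OF V U(2)] by (metis surj_pair)
      obtain m where m: "m \<ge> n" "\<And>k h. k \<ge> m \<Longrightarrow> (k, h) \<in> \<Psi> U \<Longrightarrow> (g, h) \<in> R n k"
        by (rule G.spectrum_shrink[OF \<Psi>(1)[OF U(1)] g(1)]) blast
      obtain a where a: "(m, a) \<in> U"
        using K.spectrum_threadlike[OF U(1)] unfolding threadlike_def by blast
      \<comment> \<open>Since \<open>m \<le> \<phi> m\<close>, the choice of \<open>m\<close> also
        covers level \<open>\<phi> m\<close>. Every selector of \<open>K\<close> through
        \<open>(m, a)\<close> is thus sent to one through \<open>(n, g)\<close>.\<close>
      then have ga: "(g, a) \<in> R n (\<phi> m)"
        using \<Psi>(2)[OF U(1)] m(2)[OF le_\<phi>] unfolding sub_def by blast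
      have "\<Psi> W \<in> V" if W: "W \<in> ?X" "(m, a) \<in> W" for W
      proof -
        have "(\<phi> m, a) \<in> \<Psi> W"
          using \<Psi>(2)[OF W(1)] W(2) unfolding sub_def by blast
        then have "(n, g) \<in> \<Psi> W"
          using G.threadlike_mono[OF G.spectrum_threadlike[OF \<Psi>(1)[OF W(1)]] _ ga]
            le_trans[OF m(1) le_\<phi>] by blast
        then show ?thesis
          using g(2) \<Psi>(1)[OF W(1)] by blast
      qed
      then show "\<exists>N. openin (seq_spectrum K T) N \<and> U \<in> N \<and> N \<subseteq> {U \<in> ?X. \<Psi> U \<in> V}"
        using K.openin_seq_spectrum_basic[of "(m, a)"] U(1) a by blast
    qed
  qed
  moreover have "\<Psi> ` ?X = ?Y"
  proof
    show "?Y \<subseteq> \<Psi> ` ?X"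
    proof
      fix S assume S: "S \<in> ?Y"
      then obtain U where U: "U \<in> ?X" "sub U S"
        using restrict by blast
      then have "\<Psi> U = S"
        using unique \<Psi> S by blast
      with U(1) show "S \<in> \<Psi> ` ?X"
        by blast
    qed
  qed (use \<Psi>(1) in blast)
  \<comment> \<open>A common image would contain non-adjacent elements of one level, although the
    levels of a minimal selector are cliques.\<close>
  moreover have "inj_on \<Psi> ?X"
  proof (rule inj_onI, rule ccontr)
    fix U V assume U: "U \<in> ?X" and V: "V \<in> ?X" and eq: "\<Psi> U = \<Psi> V" and neq: "U \<noteq> V"
    obtain k where k: "\<And>a b. (k, a) \<in> U \<Longrightarrow> (k, b) \<in> V \<Longrightarrow> (a, b) \<notin> edges (K k)"
      using K.spectrum_separated[OF U V neq] by blast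
    obtain a b where ab: "(k, a) \<in> U" "(k, b) \<in> V"
      using K.spectrum_threadlike[OF U] K.spectrum_threadlike[OF V] unfolding threadlike_def by blast
    then have "(\<phi> k, a) \<in> \<Psi> U" "(\<phi> k, b) \<in> \<Psi> U"
      using \<Psi>(2)[OF U] \<Psi>(2)[OF V] eq unfolding sub_def by metis+
    from G.spectrum_clique[OF \<Psi>(1)[OF U] this] have "(a, b) \<in> edges (K k)"
      using K by simp
    with k[OF ab] show False ..
  qed
  ultimately have "homeomorphic_map (seq_spectrum K T) (seq_spectrum G R) \<Psi>"
    by (intro continuous_imp_homeomorphic_map)
      (simp_all add: K.topspace_seq_spectrum G.topspace_seq_spectrum K.compact_seq_spectrum G.Hausdorff_seq_spectrum)
  then show ?thesis
    by (rule homeomorphic_map_imp_homeomorphic_space)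
qed

section \<open>Lax-Fraisse sequences\<close>

text \<open>The last branch covers the identity at \<open>m = Suc n\<close>; for
  \<open>m > Suc n\<close> its value is only a default.\<close>

primrec seq_comp ::
    "(nat \<Rightarrow> 'a graph) \<Rightarrow> (nat \<Rightarrow> ('a \<times> 'a) set) \<Rightarrow> nat \<Rightarrow> nat \<Rightarrow> ('a \<times> 'a) set" where
  "seq_comp G r m 0 = Id_on (verts (G m))"
| "seq_comp G r m (Suc n) = (if m \<le> n then seq_comp G r m n O r n else Id_on (verts (G m)))"

lemma seq_comp_refl: "seq_comp G r n n = Id_on (verts (G n))"
  by (cases n) auto

locale graph_category =
  fixes C :: "'a graph_cat"
  assumes subcategory: "subcategory_of_B C"
    and dir: "directed C"
    and amalgamation: "has_amalgamation C"
    and wide_edge_witnessing: "wide C edge_witnessing"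
    and wide_star_refining: "wide C star_refining"
begin

lemma hom_objs: "R \<in> hom C G H \<Longrightarrow> G \<in> objs C \<and> H \<in> objs C"
  using subcategory unfolding subcategory_of_B_def by blast

lemma id_hom: "G \<in> objs C \<Longrightarrow> Id_on (verts G) \<in> hom C G G"
  using subcategory unfolding subcategory_of_B_def by blast

lemma comp_hom: "Q \<in> hom C H I \<Longrightarrow> R \<in> hom C G H \<Longrightarrow> Q O R \<in> hom C G I"
  using subcategory unfolding subcategory_of_B_def by blast

lemma hom_cat_B: "R \<in> hom C G H \<Longrightarrow> R \<in> hom cat_B G H"
  using subcategory unfolding subcategory_of_B_def by blast

lemma hom_props:
  assumes "R \<in> hom C G H"
  shows "is_graph G" "is_graph H" "R \<subseteq> verts H \<times> verts G"
    "co_injective G H R" "co_surjective G H R" "edge_preserving G H R"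
  using hom_cat_B[OF assms] by (auto simp: cat_B_def co_bijective_def)

lemma hom_verts: "R \<in> hom C G H \<Longrightarrow> (h, g) \<in> R \<Longrightarrow> h \<in> verts H \<and> g \<in> verts G"
  using hom_props(3) by blast

lemma hom_ex_above: "R \<in> hom C G H \<Longrightarrow> g \<in> verts G \<Longrightarrow> \<exists>h. (h, g) \<in> R"
  using hom_props(5) unfolding co_surjective_def by blast

lemma hom_ex_below: "R \<in> hom C G H \<Longrightarrow> h \<in> verts H \<Longrightarrow> \<exists>g. (h, g) \<in> R"
  using hom_props(4) unfolding co_injective_def by blast

lemma hom_edge:
  "R \<in> hom C G H \<Longrightarrow> (h, g) \<in> R \<Longrightarrow> (h', g') \<in> R \<Longrightarrow> (g, g') \<in> edges G \<Longrightarrow> (h, h') \<in> edges H"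
  using hom_props(6) unfolding edge_preserving_def by blast

lemma hom_refl_edge: "R \<in> hom C G H \<Longrightarrow> g \<in> verts G \<Longrightarrow> (g, g) \<in> edges G"
  using hom_props(1) unfolding is_graph_def refl_on_def by blast

lemma finite_hom: "finite (hom C G H)"
proof (cases "hom C G H = {}")
  case False
  then have "finite (verts G)" "finite (verts H)"
    using hom_props(1,2) unfolding is_graph_def by blast+
  moreover have "hom C G H \<subseteq> Pow (verts H \<times> verts G)"
    using hom_props(3) by blast
  ultimately show ?thesis
    by (meson finite_Pow_iff finite_SigmaI finite_subset)
qed simp

lemma amalgamate:
  assumes "R \<in> hom C H G" "Q \<in> hom C I G"
  obtains J R' Q' where "R' \<in> hom C J H" "Q' \<in> hom C J I" "R O R' = Q O Q'"
  using assms amalgamation unfolding has_amalgamation_def by meson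

lemma idealD:
  "ideal C M \<Longrightarrow> R \<in> hom C G H \<Longrightarrow> Q \<in> hom C H I \<Longrightarrow> M G H R \<or> M H I Q \<Longrightarrow> M G I (Q O R)"
  unfolding ideal_def by blast

section \<open>Edge-surjectivity and the two ideals\<close>

text \<open>Amalgamate \<open>R\<close> with an edge-witnessing \<open>Q\<close>. A vertex
  \<open>j\<close> below a witness of the edge lies, through \<open>R'\<close>, below vertices
  \<open>g\<close> and \<open>g'\<close> over its two ends, and the loop at \<open>j\<close> makes
  these adjacent.\<close>

lemma hom_edge_surjective:
  assumes R: "R \<in> hom C G H"
  shows "edge_surjective G H R"
  unfolding edge_surjective_def
proof (intro allI impI)
  fix h h' assume edge: "(h, h') \<in> edges H"
  obtain K Q where Q: "Q \<in> hom C K H" "edge_witnessing K H Q"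
    using wide_edge_witnessing hom_objs[OF R] unfolding wide_def by blast
  obtain J R' Q' where R': "R' \<in> hom C J G" and Q': "Q' \<in> hom C J K" and eq: "R O R' = Q O Q'"
    using amalgamate[OF R Q(1)] .
  obtain k where "k \<in> verts K" "(h, k) \<in> Q" "(h', k) \<in> Q"
    using Q(2) edge unfolding edge_witnessing_def by blast
  moreover from this obtain j where "(k, j) \<in> Q'"
    using hom_ex_below[OF Q'] by blast
  ultimately have "(h, j) \<in> R O R'" "(h', j) \<in> R O R'"
    unfolding eq by blast+
  then obtain g g' where g: "(h, g) \<in> R" "(g, j) \<in> R'" "(h', g') \<in> R" "(g', j) \<in> R'"
    by blast
  have "(j, j) \<in> edges J"
    using hom_refl_edge[OF R'] hom_verts[OF R' g(2)] by blast
  then have "(g, g') \<in> edges G"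
    using hom_edge[OF R' g(2,4)] by blast
  with g show "\<exists>g g'. (g, g') \<in> edges G \<and> (h, g) \<in> R \<and> (h', g') \<in> R"
    by blast
qed

text \<open>If \<open>R\<close> is edge-witnessing, the edge is first lifted along \<open>Q\<close>
  by edge-surjectivity; if \<open>Q\<close> is, its witness is lifted along \<open>R\<close> by
  co-injectivity.\<close>

lemma edge_witnessing_ideal: "ideal C edge_witnessing"
  unfolding ideal_def
proof (intro allI impI)
  fix G H I R Q
  assume *: "R \<in> hom C G H \<and> Q \<in> hom C H I \<and> (edge_witnessing G H R \<or> edge_witnessing H I Q)"
  then have R: "R \<in> hom C G H" and Q: "Q \<in> hom C H I"
    by auto
  show "edge_witnessing G I (Q O R)"
    unfolding edge_witnessing_def
  proof (intro allI impI)
    fix i i' assume i: "(i, i') \<in> edges I"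
    have "\<exists>g. (i, g) \<in> Q O R \<and> (i', g) \<in> Q O R"
    proof (cases "edge_witnessing G H R")
      case True
      obtain h h' where "(h, h') \<in> edges H" "(i, h) \<in> Q" "(i', h') \<in> Q"
        using hom_edge_surjective[OF Q] i unfolding edge_surjective_def by blast
      moreover from this obtain g where "(h, g) \<in> R" "(h', g) \<in> R"
        using True unfolding edge_witnessing_def by blast
      ultimately show ?thesis
        by blast
    next
      case False
      then obtain h where h: "h \<in> verts H" "(i, h) \<in> Q" "(i', h) \<in> Q"
        using * i unfolding edge_witnessing_def by blast
      obtain g where "(h, g) \<in> R"
        using hom_ex_below[OF R h(1)] by blast
      with h show ?thesis
        by blast
    qed
    then show "\<exists>g\<in>verts G. (i, g) \<in> Q O R \<and> (i', g) \<in> Q O R"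
      using hom_verts[OF R] by blast
  qed
qed

text \<open>Either \<open>R\<close> puts the star of \<open>g\<close> below a single
  \<open>h\<close>, and anything above \<open>h\<close> works, or edge preservation sends the star
  of \<open>g\<close> into the star of a vertex above \<open>g\<close>, to which \<open>Q\<close>
  applies.\<close>

lemma star_refining_ideal: "ideal C star_refining"
  unfolding ideal_def
proof (intro allI impI)
  fix G H I R Q
  assume *: "R \<in> hom C G H \<and> Q \<in> hom C H I \<and> (star_refining G H R \<or> star_refining H I Q)"
  then have R: "R \<in> hom C G H" and Q: "Q \<in> hom C H I"
    by auto
  show "star_refining G I (Q O R)"
    unfolding star_refining_def
  proof
    fix g assume g: "g \<in> verts G"
    show "\<exists>i\<in>verts I. {g'. (g', g) \<in> edges G} \<subseteq> (Q O R) `` {i}"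
    proof (cases "star_refining G H R")
      case True
      then obtain h where h: "h \<in> verts H" "{g'. (g', g) \<in> edges G} \<subseteq> R `` {h}"
        using g unfolding star_refining_def by blast
      obtain i where i: "(i, h) \<in> Q"
        using hom_ex_above[OF Q h(1)] by blast
      have "{g'. (g', g) \<in> edges G} \<subseteq> (Q O R) `` {i}"
        using h(2) i by blast
      then show ?thesis
        using hom_verts[OF Q i] by blast
    next
      case False
      obtain h where h: "(h, g) \<in> R"
        using hom_ex_above[OF R g] by blast
      then have "h \<in> verts H"
        using hom_verts[OF R] by blast
      then obtain i where i: "i \<in> verts I" "{h'. (h', h) \<in> edges H} \<subseteq> Q `` {i}"
        using False * unfolding star_refining_def by blast
      have "(i, g') \<in> Q O R" if g': "(g', g) \<in> edges G" for g'
      proof -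
        have "g' \<in> verts G"
          using g' hom_props(1)[OF R] unfolding is_graph_def by blast
        then obtain h' where h': "(h', g') \<in> R"
          using hom_ex_above[OF R] by blast
        then have "(h', h) \<in> edges H"
          using hom_edge[OF R _ h g'] by blast
        with i(2) h' show ?thesis
          by blast
      qed
      with i(1) show ?thesis
        by blast
    qed
  qed
qed

lemma graph_seq:
  assumes "sequence_in C G R"
  shows "graph_seq G R"
proof -
  have "objs C \<subseteq> objs cat_B"
    using subcategory by (simp add: subcategory_of_B_def)
  then have "G n \<in> objs cat_B" for n
    using assms by (auto simp: sequence_in_def)
  moreover have "R m n \<in> hom cat_B (G n) (G m)" if "m \<le> n" for m n
    using assms that by (simp add: sequence_in_def hom_cat_B)
  ultimately show ?thesis
    using assms by (simp add: graph_seq_def sequence_in_def)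
qed

lemma sequence_seq_comp:
  assumes r: "\<And>n. r n \<in> hom C (G (Suc n)) (G n)"
  shows "sequence_in C G (seq_comp G r)"
proof -
  have objs: "G n \<in> objs C" for n
    using hom_objs[OF r] by blast
  have hom: "seq_comp G r m n \<in> hom C (G n) (G m)" if "m \<le> n" for m n
    using that
  proof (induction n)
    case 0
    then show ?case
      using id_hom[OF objs] by simp
  next
    case (Suc n)
    show ?case
    proof (cases "m \<le> n")
      case True
      then show ?thesis
        using comp_hom[OF Suc.IH r] by simp
    next
      case False
      then have "m = Suc n"
        using Suc.prems by simp
      then show ?thesis
        using id_hom[OF objs] by simp
    qed
  qed
  have "seq_comp G r l m O seq_comp G r m n = seq_comp G r l n" if "l \<le> m" "m \<le> n" for l m n
    using that(2)
  proof (induction n rule: dec_induct)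
    case base
    show ?case
      using hom_verts[OF hom[OF that(1)]] by (auto simp: seq_comp_refl)
  next
    case (step n)
    then show ?case
      using that(1) by (simp flip: O_assoc)
  qed
  with objs hom show ?thesis
    unfolding sequence_in_def by (simp add: seq_comp_refl)
qed

lemma sequence_subsequence:
  assumes "sequence_in C G R" "strict_mono \<phi>"
  shows "sequence_in C (\<lambda>n. G (\<phi> n)) (\<lambda>m n. R (\<phi> m) (\<phi> n))"
  using assms unfolding sequence_in_def by (simp add: strict_mono_less_eq)

section \<open>Consequences of the lax Fraisse property\<close>

text \<open>One further morphism of the sequence makes the index strictly larger, as subsequences
  and the back-and-forth construction require.\<close>

lemma lax_fraisse_sequence_step:
  assumes lax: "lax_fraisse_sequence C G R" and Q: "Q \<in> hom C H (G m)"
  obtains n P where "n > m" "P \<in> hom C (G n) H" "Q O P \<subseteq> R m n"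
proof -
  have seq: "sequence_in C G R"
    using lax by (simp add: lax_fraisse_sequence_def)
  obtain n P where n: "n \<ge> m" "P \<in> hom C (G n) H" "Q O P \<subseteq> R m n"
    using lax Q hom_objs[OF Q] unfolding lax_fraisse_sequence_def by blast
  have "R n (Suc n) \<in> hom C (G (Suc n)) (G n)" "R m n O R n (Suc n) = R m (Suc n)"
    using seq n(1) unfolding sequence_in_def by auto
  then have "P O R n (Suc n) \<in> hom C (G (Suc n)) H" "Q O (P O R n (Suc n)) \<subseteq> R m (Suc n)"
    using comp_hom n(2,3) by blast+
  then show ?thesis
    using that n(1) by (meson le_imp_less_Suc)
qed

text \<open>Wideness gives a morphism into \<open>G m\<close> with property \<open>M\<close>, and
  the ideal property keeps \<open>M\<close> for its composite with \<open>P\<close>. Monotonicity of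
  \<open>M\<close> bridges the lax inclusion into \<open>R m n\<close>.\<close>

lemma lax_fraisse_sequence_has:
  assumes lax: "lax_fraisse_sequence C G R" and "wide C M" and "ideal C M"
    and mono: "\<And>G H R R'. M G H R \<Longrightarrow> R \<subseteq> R' \<Longrightarrow> M G H R'"
  shows "\<exists>n>m. M (G n) (G m) (R m n)"
proof -
  have "G m \<in> objs C"
    using lax by (simp add: lax_fraisse_sequence_def sequence_in_def)
  then obtain H Q where Q: "Q \<in> hom C H (G m)" "M H (G m) Q"
    using assms(2) unfolding wide_def by blast
  obtain n P where n: "n > m" "P \<in> hom C (G n) H" "Q O P \<subseteq> R m n"
    using lax_fraisse_sequence_step[OF lax Q(1)] .
  have "M (G n) (G m) (Q O P)"
    using idealD[OF assms(3) n(2) Q(1)] Q(2) by simp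
  then show ?thesis
    using n(1) mono[OF _ n(3)] by blast
qed

text \<open>It suffices that consecutive terms satisfy \<open>M\<close>: every other morphism of the
  subsequence has such a factor, and \<open>M\<close> is an ideal.\<close>

lemma lax_fraisse_sequence_has_subseq_with:
  assumes lax: "lax_fraisse_sequence C G R" and wide: "wide C M" and ideal: "ideal C M"
    and mono: "\<And>G H R R'. M G H R \<Longrightarrow> R \<subseteq> R' \<Longrightarrow> M G H R'"
  shows "has_subseq_with M G R"
proof -
  \<comment> \<open>The conjunct \<open>True\<close> is the trivial invariant passed to
    \<open>dependent_nat_choice\<close>.\<close>
  have "\<exists>n. True \<and> n > m \<and> M (G n) (G m) (R m n)" for m
    using lax_fraisse_sequence_has[OF lax wide ideal] mono by blast
  then obtain \<phi> where \<phi>: "\<And>n. \<phi> (Suc n) > \<phi> n"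
      "\<And>n. M (G (\<phi> (Suc n))) (G (\<phi> n)) (R (\<phi> n) (\<phi> (Suc n)))"
    using dependent_nat_choice[of "\<lambda>_ _. True" "\<lambda>_ m n. n > m \<and> M (G n) (G m) (R m n)"] by auto
  then have sm: "strict_mono \<phi>"
    by (simp add: strict_mono_Suc_iff)
  have "M (G (\<phi> n)) (G (\<phi> m)) (R (\<phi> m) (\<phi> n))" if "m < n" for m n
  proof -
    have "\<phi> m \<le> \<phi> (Suc m)" "\<phi> (Suc m) \<le> \<phi> n"
      using sm that by (auto simp: strict_mono_less_eq)
    then have "R (\<phi> m) (\<phi> (Suc m)) \<in> hom C (G (\<phi> (Suc m))) (G (\<phi> m))"
        "R (\<phi> (Suc m)) (\<phi> n) \<in> hom C (G (\<phi> n)) (G (\<phi> (Suc m)))"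
        "R (\<phi> m) (\<phi> (Suc m)) O R (\<phi> (Suc m)) (\<phi> n) = R (\<phi> m) (\<phi> n)"
      using lax by (simp_all add: lax_fraisse_sequence_def sequence_in_def)
    then show ?thesis
      using \<phi>(2)[of m] idealD[OF ideal] by metis
  qed
  with sm show ?thesis
    unfolding has_subseq_with_def seq_has_def by blast
qed

lemma edge_witnessing_mono: "edge_witnessing G H R \<Longrightarrow> R \<subseteq> R' \<Longrightarrow> edge_witnessing G H R'"
  unfolding edge_witnessing_def by blast

lemma star_refining_mono: "star_refining G H R \<Longrightarrow> R \<subseteq> R' \<Longrightarrow> star_refining G H R'"
  unfolding star_refining_def by blast

lemma lax_fraisse_sequence_star_seq:
  assumes lax: "lax_fraisse_sequence C G R"
  shows "star_seq G R"
proof -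
  interpret graph_seq G R
    using lax by (intro graph_seq) (simp add: lax_fraisse_sequence_def)
  show ?thesis
  proof
    fix m
    obtain k where "k > m" "star_refining (G k) (G m) (R m k)"
      using lax_fraisse_sequence_has[OF lax wide_star_refining star_refining_ideal] star_refining_mono by blast
    then show "\<exists>k\<ge>m. star_refining (G k) (G m) (R m k)"
      using less_imp_le by blast
  qed
qed

text \<open>A later edge-witnessing morphism supplies the common lower bound; conversely the loop at
  a common lower bound is mapped to an edge.\<close>

lemma lax_fraisse_sequence_edge_faithful:
  assumes lax: "lax_fraisse_sequence C G R"
  shows "edge_faithful G R"
proof -
  interpret graph_seq G R
    using lax by (intro graph_seq) (simp add: lax_fraisse_sequence_def)
  show ?thesis
    unfolding edge_faithful_def
  proof (intro allI ballI iffI)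
    fix n g h assume "(g, h) \<in> edges (G n)"
    moreover obtain m where m: "m > n" "edge_witnessing (G m) (G n) (R n m)"
      using lax_fraisse_sequence_has[OF lax wide_edge_witnessing edge_witnessing_ideal] edge_witnessing_mono by blast
    ultimately obtain x where "x \<in> verts (G m)" "(g, x) \<in> R n m" "(h, x) \<in> R n m"
      unfolding edge_witnessing_def by blast
    then show "\<exists>x\<in>ind_poset G. (x, (n, g)) \<in> ind_order G R \<and> (x, (n, h)) \<in> ind_order G R"
      using m(1) by (intro bexI[of _ "(m, x)"]) (auto simp: order_iff poset_iff)
  next
    fix n g h assume "\<exists>x\<in>ind_poset G. (x, (n, g)) \<in> ind_order G R \<and> (x, (n, h)) \<in> ind_order G R"
    then obtain m x where "x \<in> verts (G m)" "n \<le> m" "(g, x) \<in> R n m" "(h, x) \<in> R n m"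
      by (auto simp: order_iff poset_iff)
    then show "(g, h) \<in> edges (G n)"
      using R_edge edge_refl by blast
  qed
qed

end

section \<open>Back-and-forth between lax-Fraisse sequences\<close>

context graph_category
begin

text \<open>
  The sequence \<open>X n\<close> is meant to alternate between two sequences: \<open>X n (i n)\<close> is the \<open>n\<close>-th term of
  the back-and-forth construction and \<open>P n\<close> the morphism from the next term to it.
\<close>

lemma interleaved_sequence:
  assumes lax: "\<And>n. lax_fraisse_sequence C (X n) (Y n)"
    and X: "\<And>n. X (Suc (Suc n)) = X n"
  obtains i P where "\<And>n. i n < i (Suc (Suc n))"
    and "\<And>n. P n \<in> hom C (X (Suc n) (i (Suc n))) (X n (i n))"
    and "\<And>n. star_refining (X (Suc (Suc n)) (i (Suc (Suc n)))) (X (Suc n) (i (Suc n))) (P (Suc n))"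
    and "\<And>n. P n O P (Suc n) \<subseteq> Y n (i n) (i (Suc (Suc n)))"
proof -
  define ok where "ok n x \<longleftrightarrow> (case x of (i, j, P) \<Rightarrow> P \<in> hom C (X (Suc n) j) (X n i))" for n x
  \<comment> \<open>A state holds the current index, the next index and the morphism between their
    terms, so consecutive states share an index.\<close>
  define step where "step n x y \<longleftrightarrow> (case x of (i, j, P) \<Rightarrow> case y of (i', j', P') \<Rightarrow>
      i' = j \<and> i < j' \<and> star_refining (X (Suc (Suc n)) j') (X (Suc n) j) P' \<and> P O P' \<subseteq> Y n i j')" for n x y
  have "\<exists>x. ok 0 x"
  proof -
    have "X 0 0 \<in> objs C"
      using lax[of 0] by (simp add: lax_fraisse_sequence_def sequence_in_def)
    \<comment> \<open>Cofinality gives no star refinement here, so only the morphisms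
      \<open>P (Suc n)\<close> are claimed to be star-refining.\<close>
    then obtain j P where "P \<in> hom C (X (Suc 0) j) (X 0 0)"
      using lax[of "Suc 0"] unfolding lax_fraisse_sequence_def cofinal_seq_def by blast
    then show ?thesis
      by (intro exI[of _ "(0, j, P)"]) (simp add: ok_def)
  qed
  moreover have "\<exists>y. ok (Suc n) y \<and> step n x y" if x: "ok n x" for x n
  proof -
    obtain i j P where ijP: "x = (i, j, P)"
      by (cases x)
    then have P: "P \<in> hom C (X (Suc n) j) (X n i)"
      using x by (simp add: ok_def)
    \<comment> \<open>Inserting a star-refining \<open>W\<close> before the lax property is used
      makes the next morphism \<open>W O V\<close> star-refining.\<close>
    obtain Z W where W: "W \<in> hom C Z (X (Suc n) j)" "star_refining Z (X (Suc n) j) W"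
      using wide_star_refining hom_objs[OF P] unfolding wide_def by blast
    obtain j' V where V: "j' > i" "V \<in> hom C (X n j') Z" "(P O W) O V \<subseteq> Y n i j'"
      using lax_fraisse_sequence_step[OF lax comp_hom[OF P W(1)]] .
    have "star_refining (X n j') (X (Suc n) j) (W O V)"
      using idealD[OF star_refining_ideal V(2) W(1)] W(2) by simp
    then show ?thesis
      using comp_hom[OF W(1) V(2)] V(1,3) X
      by (intro exI[of _ "(j, j', W O V)"]) (simp add: ijP ok_def step_def O_assoc)
  qed
  ultimately obtain f where f: "\<And>n. ok n (f n)" "\<And>n. step n (f n) (f (Suc n))"
    using dependent_nat_choice[of ok step] by blast
  define i P where "i n = fst (f n)" and "P n = snd (snd (f n))" for n
  have f_eq: "f n = (i n, i (Suc n), P n)" for n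
    using f(2)[of n] by (auto simp: step_def i_def P_def split: prod.splits)
  show ?thesis
    using f by (intro that[of i P]) (simp_all add: f_eq ok_def step_def)
qed

text \<open>Both spectra are compared with that of the interleaved sequence \<open>H\<close>. The
  terms of one parity form a subsequence of \<open>H\<close> and, with smaller relations, a
  subsequence of one of the given sequences.\<close>

lemma homeomorphic_lax_fraisse_spectra:
  assumes lax: "lax_fraisse_sequence C G R" and lax': "lax_fraisse_sequence C G' R'"
  shows "seq_spectrum G R homeomorphic_space seq_spectrum G' R'"
proof -
  define X where "X n = (if even n then G else G')" for n :: nat
  define Y where "Y n = (if even n then R else R')" for n :: nat
  have laxX: "lax_fraisse_sequence C (X n) (Y n)" for n
    using lax lax' by (simp add: X_def Y_def)
  have XX: "X (Suc (Suc n)) = X n" for n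
    by (simp add: X_def)
  obtain i P where i: "\<And>n. i n < i (Suc (Suc n))"
    and P: "\<And>n. P n \<in> hom C (X (Suc n) (i (Suc n))) (X n (i n))"
    and star: "\<And>n. star_refining (X (Suc (Suc n)) (i (Suc (Suc n)))) (X (Suc n) (i (Suc n))) (P (Suc n))"
    and PP: "\<And>n. P n O P (Suc n) \<subseteq> Y n (i n) (i (Suc (Suc n)))"
    by (rule interleaved_sequence[of X Y, OF laxX XX]) (rule that)
  define H where "H n = X n (i n)" for n
  define S where "S = seq_comp H P"
  have P_hom: "P n \<in> hom C (H (Suc n)) (H n)" for n
    using P by (simp add: H_def)
  then have seqS: "sequence_in C H S"
    unfolding S_def by (rule sequence_seq_comp)
  have S_hom: "S m n \<in> hom C (H n) (H m)" if "m \<le> n" for m n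
    using seqS that by (simp add: sequence_in_def)
  have S_Suc: "S m (Suc n) = S m n O P n" if "m \<le> n" for m n
    using that by (simp add: S_def)
  \<comment> \<open>Two steps ensure a factor \<open>P (Suc m)\<close>; a single step might be
    \<open>P 0\<close>, about which nothing is known.\<close>
  have S_star: "star_refining (H n) (H m) (S m n)" if mn: "m + 2 \<le> n" for m n
  proof -
    have "star_refining (H (Suc (Suc m))) (H m) (S m (Suc m) O P (Suc m))"
      using star[of m] by (intro idealD[OF star_refining_ideal P_hom S_hom]) (simp_all add: H_def)
    then have "star_refining (H (Suc (Suc m))) (H m) (S m (Suc (Suc m)))"
      by (simp only: S_Suc le_SucI le_refl)
    then have "star_refining (H n) (H m) (S m (Suc (Suc m)) O S (Suc (Suc m)) n)"
      using mn by (intro idealD[OF star_refining_ideal S_hom S_hom]) simp_all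
    then show ?thesis
      using seqS mn by (simp add: sequence_in_def)
  qed
  \<comment> \<open>The cases \<open>e = 0\<close> and \<open>e = 1\<close> give the even and the
    odd terms.\<close>
  have "seq_spectrum (X e) (Y e) homeomorphic_space seq_spectrum H S" for e
  proof -
    let ?\<phi> = "\<lambda>n. e + 2 * n"
    let ?K = "\<lambda>n. H (?\<phi> n)" and ?T = "\<lambda>m n. S (?\<phi> m) (?\<phi> n)"
    have \<phi>: "strict_mono ?\<phi>"
      by (simp add: strict_mono_Suc_iff)
    have i\<phi>: "strict_mono (\<lambda>n. i (?\<phi> n))"
      using i by (simp add: strict_mono_Suc_iff)
    have XY: "X (?\<phi> n) = X e" "Y (?\<phi> n) = Y e" for n
      by (simp_all add: X_def Y_def)
    have seqY: "sequence_in C (X e) (Y e)"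
      using laxX[of e] by (simp add: lax_fraisse_sequence_def)
    have "star_seq ?K ?T"
      unfolding star_seq_def star_seq_axioms_def
    proof (intro conjI allI)
      show "graph_seq ?K ?T"
        using graph_seq[OF sequence_subsequence[OF seqS \<phi>]] .
      show "\<exists>k\<ge>m. star_refining (?K k) (?K m) (?T m k)" for m
        by (rule exI[of _ "Suc m"]) (simp add: S_star)
    qed
    moreover have "?T m n \<subseteq> Y e (i (?\<phi> m)) (i (?\<phi> n))" if "m \<le> n" for m n
      using that
    proof (induction n rule: dec_induct)
      case base
      then show ?case
        using seqY XY(1)[of m] by (simp add: S_def seq_comp_refl sequence_in_def H_def)
    next
      case (step n)
      have le: "i (?\<phi> m) \<le> i (?\<phi> n)" "i (?\<phi> n) \<le> i (?\<phi> (Suc n))"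
        using i\<phi> step(1) i[of "?\<phi> n"] by (auto simp: strict_mono_less_eq[OF i\<phi>])
      have "?T m (Suc n) = ?T m n O (P (?\<phi> n) O P (Suc (?\<phi> n)))"
        using step(1) by (simp add: S_Suc O_assoc)
      also have "\<dots> \<subseteq> Y e (i (?\<phi> m)) (i (?\<phi> n)) O Y e (i (?\<phi> n)) (i (?\<phi> (Suc n)))"
        using step.IH PP[of "?\<phi> n"] XY(2)[of n] by (intro relcomp_mono) simp_all
      also have "\<dots> = Y e (i (?\<phi> m)) (i (?\<phi> (Suc n)))"
        by (rule graph_seq.R_comp[OF graph_seq[OF seqY] le])
      finally show ?case .
    qed
    ultimately have "seq_spectrum ?K ?T homeomorphic_space seq_spectrum (X e) (Y e)"
      using homeomorphic_spectrum_lax_subsequence[OF graph_seq[OF seqY] _ i\<phi>] XY(1) by (simp add: H_def)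
    moreover have "seq_spectrum ?K ?T homeomorphic_space seq_spectrum H S"
      by (rule homeomorphic_spectrum_lax_subsequence[OF graph_seq[OF seqS] \<open>star_seq ?K ?T\<close> \<phi>]) simp_all
    ultimately show ?thesis
      using homeomorphic_space_sym homeomorphic_space_trans by blast
  qed
  from this[of 0] this[of 1] have "seq_spectrum G R homeomorphic_space seq_spectrum H S"
      "seq_spectrum G' R' homeomorphic_space seq_spectrum H S"
    by (simp_all add: X_def Y_def)
  then show ?thesis
    using homeomorphic_space_sym homeomorphic_space_trans by blast
qed

section \<open>Existence of Fraisse sequences\<close>

text \<open>The morphisms are amalgamated with \<open>Q\<close> one after another; earlier solutions
  survive precomposition with the new leg \<open>r'\<close>.\<close>

lemma amalgamate_finitely_many:
  assumes "finite F" "F \<subseteq> hom C G K" and Q: "Q \<in> hom C H K" and G: "G \<in> objs C"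
  shows "\<exists>J. \<exists>r\<in>hom C J G. \<forall>f\<in>F. \<exists>P\<in>hom C J H. Q O P = f O r"
  using assms(1,2)
proof (induction F rule: finite_induct)
  case empty
  then show ?case
    using id_hom[OF G] by blast
next
  case (insert f F)
  then have F: "F \<subseteq> hom C G K" and f: "f \<in> hom C G K"
    by simp_all
  obtain J r where r: "r \<in> hom C J G" "\<And>f. f \<in> F \<Longrightarrow> \<exists>P\<in>hom C J H. Q O P = f O r"
    using insert.IH[OF F] by auto
  obtain J' Q' r' where J': "Q' \<in> hom C J' H" "r' \<in> hom C J' J" "Q O Q' = (f O r) O r'"
    using amalgamate[OF Q comp_hom[OF f r(1)]] .
  have "\<exists>P\<in>hom C J' H. Q O P = g O (r O r')" if "g \<in> insert f F" for g
  proof (cases "g = f")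
    case True
    then show ?thesis
      using J'(1,3) by (auto simp only: O_assoc)
  next
    case False
    then have "g \<in> F"
      using that by simp
    then obtain P where P: "P \<in> hom C J H" "Q O P = g O r"
      using r(2) by blast
    then have "Q O (P O r') = g O (r O r')"
      by (metis O_assoc)
    then show ?thesis
      using comp_hom[OF P(1) J'(2)] by blast
  qed
  then show ?case
    using comp_hom[OF r(1) J'(2)] by blast
qed

text \<open>Isomorphisms reduce everything to the objects in \<open>D\<close>, between which there
  are only countably many morphisms. The resulting extension problems are dovetailed, and stage
  \<open>n\<close> also maps to \<open>d n\<close> for cofinality.\<close>

lemma ex_fraisse_sequence:
  assumes "essentially_countable C"
  shows "\<exists>G R. fraisse_sequence C G R"
proof -
  obtain D where D: "countable D" "D \<subseteq> objs C"
    and iso: "\<And>G. G \<in> objs C \<Longrightarrow> \<exists>H\<in>D. isomorphic_in C G H"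
    using assms unfolding essentially_countable_def by blast
  have "D \<noteq> {}"
    using dir iso unfolding directed_def by blast
  then obtain d :: "nat \<Rightarrow> 'a graph" where d: "range d = D"
    using D(1) uncountable_def by metis
  define Tasks where "Tasks = (SIGMA H:D. SIGMA K:D. hom C H K)"
  have "countable Tasks"
    unfolding Tasks_def using D(1) by (intro countable_SIGMA countable_finite[OF finite_hom])
  moreover have "Tasks \<noteq> {}"
    using \<open>D \<noteq> {}\<close> id_hom D(2) unfolding Tasks_def by blast
  ultimately obtain t :: "nat \<Rightarrow> _" where t: "range t = Tasks"
    using uncountable_def by metis
  \<comment> \<open>Extending all morphisms from \<open>G\<close> to \<open>K\<close> at once, and not just one of the form \<open>R m n\<close>, makes
    the condition on a stage independent of the previous ones. Each task recurs at arbitrarily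
    late stages.\<close>
  define step where "step n G G' r \<longleftrightarrow> r \<in> hom C G' G \<and> hom C G' (d n) \<noteq> {} \<and>
      (\<forall>H K Q. t (fst (prod_decode n)) = (H, K, Q) \<longrightarrow>
        (\<forall>f\<in>hom C G K. \<exists>P\<in>hom C G' H. Q O P = f O r))" for n G G' r
  have "\<exists>G'. G' \<in> D \<and> (\<exists>r. step n G G' r)" if G: "G \<in> D" for n G
  proof -
    obtain H K Q where HKQ: "t (fst (prod_decode n)) = (H, K, Q)"
      by (metis prod_cases3)
    have "(H, K, Q) \<in> Tasks"
      unfolding t[symmetric] HKQ[symmetric] by (rule rangeI)
    then have Q: "Q \<in> hom C H K"
      by (auto simp: Tasks_def)
    have "G \<in> objs C"
      using G D(2) by blast
    from amalgamate_finitely_many[OF finite_hom order_refl Q this]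
    obtain J r where r: "r \<in> hom C J G" "\<And>f. f \<in> hom C G K \<Longrightarrow> \<exists>P\<in>hom C J H. Q O P = f O r"
      by blast
    have "J \<in> objs C" "d n \<in> objs C"
      using hom_objs[OF r(1)] d D(2) by blast+
    then obtain I u v where I: "I \<in> objs C" and u: "u \<in> hom C I J" and v: "v \<in> hom C I (d n)"
      using dir unfolding directed_def by blast
    \<comment> \<open>The construction returns to \<open>D\<close> along one half of an
      isomorphism.\<close>
    obtain G' w where G': "G' \<in> D" and w: "w \<in> hom C G' I"
      using iso[OF I] unfolding isomorphic_in_def by blast
    have uw: "u O w \<in> hom C G' J"
      using comp_hom[OF u w] .
    have "\<exists>P\<in>hom C G' H. Q O P = f O (r O (u O w))" if f: "f \<in> hom C G K" for f
    proof -
      obtain P where P: "P \<in> hom C J H" "Q O P = f O r"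
        using r(2)[OF f] by blast
      have "Q O (P O (u O w)) = f O (r O (u O w))"
        using P(2) by (metis O_assoc)
      then show ?thesis
        using comp_hom[OF P(1) uw] by blast
    qed
    then have "step n G G' (r O (u O w))"
      using comp_hom[OF r(1) uw] comp_hom[OF v w] HKQ unfolding step_def by auto
    with G' show ?thesis
      by blast
  qed
  then obtain G where G: "\<And>n. G n \<in> D" "\<And>n. \<exists>r. step n (G n) (G (Suc n)) r"
    using dependent_nat_choice[of "\<lambda>_ G. G \<in> D" "\<lambda>n G G'. \<exists>r. step n G G' r"] \<open>D \<noteq> {}\<close> by blast
  then obtain r where r: "\<And>n. step n (G n) (G (Suc n)) (r n)"
    by metis
  define R where "R = seq_comp G r"
  have r_hom: "r n \<in> hom C (G (Suc n)) (G n)" for n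
    using r[of n] by (simp add: step_def)
  have seq: "sequence_in C G R"
    unfolding R_def using r_hom by (rule sequence_seq_comp)
  have "\<exists>n. hom C (G n) H \<noteq> {}" if H: "H \<in> objs C" for H
  proof -
    obtain H' Q where "H' \<in> D" "Q \<in> hom C H' H"
      using iso[OF H] unfolding isomorphic_in_def by blast
    moreover from this obtain n where "H' = d n"
      using d by blast
    moreover obtain P where "P \<in> hom C (G (Suc n)) (d n)"
      using r[of n] unfolding step_def by blast
    ultimately show ?thesis
      using comp_hom by blast
  qed
  then have "cofinal_seq C G"
    unfolding cofinal_seq_def by blast
  moreover have "\<exists>n\<ge>m. \<exists>P\<in>hom C (G n) H. Q O P = R m n"
    if H: "H \<in> objs C" and Q: "Q \<in> hom C H (G m)" for m H Q
  proof -
    obtain H' v where H': "H' \<in> D" and v: "v \<in> hom C H' H"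
      using iso[OF H] unfolding isomorphic_in_def by blast
    \<comment> \<open>Replacing \<open>H\<close> by its copy \<open>H'\<close> turns
      \<open>Q\<close> into the task \<open>Q O v\<close>; a solution \<open>P\<close> of it gives
      \<open>v O P\<close>.\<close>
    have "(H', G m, Q O v) \<in> Tasks"
      using H' G(1) comp_hom[OF Q v] by (simp add: Tasks_def)
    then obtain k where k: "t k = (H', G m, Q O v)"
      unfolding t[symmetric] by (metis rangeE)
    \<comment> \<open>The first component selects the task, and the second ensures
      \<open>m \<le> n\<close>, so that \<open>R m n\<close> is among the morphisms treated at stage
      \<open>n\<close>.\<close>
    define n where "n = prod_encode (k, m)"
    have n: "m \<le> n"
      unfolding n_def by (rule le_prod_encode_2)
    have "R m n \<in> hom C (G n) (G m)"
      using seq n by (simp add: sequence_in_def)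
    moreover have "t (fst (prod_decode n)) = (H', G m, Q O v)"
      by (simp add: n_def k)
    ultimately obtain P where P: "P \<in> hom C (G (Suc n)) H'" "(Q O v) O P = R m n O r n"
      using r[of n] unfolding step_def by blast
    have "Q O (v O P) = R m (Suc n)"
      using P(2) n by (simp add: R_def O_assoc)
    with comp_hom[OF v P(1)] n show ?thesis
      using le_SucI by blast
  qed
  ultimately show ?thesis
    using seq unfolding fraisse_sequence_def by blast
qed

end

theorem theorem4p34:
  fixes C :: "'a graph_cat"
  assumes "subcategory_of_B C"
    and "directed C"
    and "has_amalgamation C"
    and "wide C edge_witnessing"
    and "wide C star_refining"
  shows
    "(essentially_countable C \<longrightarrow> (\<exists>G R. fraisse_sequence C G R)) \<and>
     ((\<forall>G H R. R \<in> hom C G H \<longrightarrow> edge_surjective G H R) \<and>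
      wide C edge_witnessing \<and> ideal C edge_witnessing \<and>
      wide C star_refining \<and> ideal C star_refining) \<and>
     (\<forall>G R. lax_fraisse_sequence C G R \<longrightarrow>
        edge_faithful G R \<and> has_subseq_with edge_witnessing G R \<and>
        has_subseq_with star_refining G R) \<and>
     (\<forall>G R G' R'. lax_fraisse_sequence C G R \<and> lax_fraisse_sequence C G' R' \<longrightarrow>
        seq_spectrum G R homeomorphic_space seq_spectrum G' R') \<and>
     (\<forall>G R. lax_fraisse_sequence C G R \<longrightarrow> metrizable_space (seq_spectrum G R))"
proof -
  interpret graph_category C
    using assms by unfold_locales
  have "has_subseq_with edge_witnessing G R" if "lax_fraisse_sequence C G R" for G R
    using that wide_edge_witnessing edge_witnessing_ideal edge_witnessing_mono
    by (rule lax_fraisse_sequence_has_subseq_with)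
  moreover have "has_subseq_with star_refining G R" if "lax_fraisse_sequence C G R" for G R
    using that wide_star_refining star_refining_ideal star_refining_mono
    by (rule lax_fraisse_sequence_has_subseq_with)
  moreover have "metrizable_space (seq_spectrum G R)" if "lax_fraisse_sequence C G R" for G R
    using lax_fraisse_sequence_star_seq[OF that] by (rule star_seq.metrizable_seq_spectrum)
  ultimately show ?thesis
    using ex_fraisse_sequence hom_edge_surjective assms(4,5) edge_witnessing_ideal star_refining_ideal
      lax_fraisse_sequence_edge_faithful homeomorphic_lax_fraisse_spectra
    by (intro conjI allI impI) simp_all
qed

end
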